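(* Suppose $\lambda\in\mathcal{M}_+^{(2)}(\mathbb{R})$, and fix $c_1\ge0$ and $c_0\in\mathbb{R}$. There is a unique measure $\mu\in\mathcal{M}_+^{(2)}(\mathbb{R})$ and unique values $\zeta_1\ge0$ and $\zeta_0\in\mathbb{R}$ such that $$\big(Q_{\mathrm{reg}}[\lambda](z)-i\pi^{-1}(c_0+c_1z)\big)\big(Q_{\mathrm{reg}}[\mu](z)-i\pi^{-1}(\zeta_0+\zeta_1z)\big)\equiv1$$ for $z\in\mathbb{H}$. In this context, write $\mathcal{B}_{\mathrm{reg}}[\lambda,c_0,c_1]=(\mu,\zeta_0,\zeta_1)$. The map $\mathcal{B}_{\mathrm{reg}}$ is continuous in the pullback of the weak topology on $\mathcal{M}_+(S^1)$ (and the standard topology on $\mathbb{R}$) under $\Psi_{\mathrm{reg}}$. If $\lambda$ is even and $c_0=0$, then $\mu$ is even and $\zeta_0=0$.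
   Context: $\mathbb{H}=\{\operatorname{Im}z>0\}$. $\mathcal{M}_+^{(2)}(\mathbb{R})$ is the set of non-negative Borel measures $\lambda$ on $\mathbb{R}$ of locally bounded variation, excluding the zero measure, with $\int(1+s^2)^{-1}\,d\lambda(s)<\infty$. $\mathcal{M}_+(S^1)$ is the set of finite non-negative Borel measures on the unit circle, excluding the zero measure. The regularized Cauchy transform is $$Q_{\mathrm{reg}}[\lambda](z)=\int\frac{i}{\pi}\left(\frac1{z-s}+\frac{s}{1+s^2}\right)d\lambda(s),\qquad z\in\mathbb{H}.$$ Let $\phi(z)=i\frac{1-z}{1+z}$ be the Cayley map from the unit disc to the upper half-plane, with $\phi^{-1}(w)=\frac{i-w}{i+w}$, mapping $S^1\setminus\{-1\}$ to $\mathbb{R}$. For $\lambda\in\mathcal{M}_+^{(2)}(\mathbb{R})$, $\psi[\lambda]$ is the finite measure on $S^1$ given by $d\lambda(s)=\pi(1+s^2)\,\phi_*\psi[d\lambda](s)$, i.e. the pushforward under $\phi^{-1}$ of $\frac{d\lambda(s)}{\pi(1+s^2)}$. Then $$\Psi_{\mathrm{reg}}:\mathcal{M}_+^{(2)}(\mathbb{R})\times\mathbb{R}\times[0,\infty)\to\mathcal{M}_+(S^1)\times\mathbb{R},\qquad\Psi_{\mathrm{reg}}[\lambda,c_0,c_1]=\big(\psi[\lambda]+\pi^{-1}c_1\delta_{-1},\,-\pi^{-1}c_0\big),$$ with $\delta_{-1}$ the unit point mass at $-1\in S^1$. "Even" means invariant under $s\mapsto-s$.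
   Formalization: The measure μ is allowed to be zero: for c_1=0, λ=mδ_a (m>0), c_0=ma/(1+a²) the dual has μ=0, so the literal claim fails; it is proved that a unique non-zero μ exists exactly outside this family. Continuity and evenness hold for all data, with μ=0 allowed. *)

theory Defs
  imports "HOL-Probability.Probability"
begin

text \<open>Borel measures on the real line are values of type \<open>real measure\<close> with the Borel sigma-algebra,
  so that equality of such values is equality of measures. \<open>M2_nonneg\<close> contains the zero
  measure, \<open>M2_plus\<close> does not.\<close>

definition M2_nonneg :: "real measure set" where
  "M2_nonneg = {lam. sets lam = sets borel
      \<and> (\<forall>K. compact K \<longrightarrow> emeasure lam K < \<infinity>)
      \<and> (\<integral>\<^sup>+ s. ennreal (1 / (1 + s\<^sup>2)) \<partial>lam) < \<infinity>}"

definition M2_plus :: "real measure set" where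
  "M2_plus = M2_nonneg - {null_measure borel}"

definition even_measure :: "real measure \<Rightarrow> bool" where
  "even_measure lam \<longleftrightarrow> distr lam borel uminus = lam"

definition Q_reg :: "real measure \<Rightarrow> complex \<Rightarrow> complex" where
  "Q_reg lam z = (\<integral>s. (\<i> / pi) * (1 / (z - complex_of_real s) + complex_of_real (s / (1 + s\<^sup>2))) \<partial>lam)"

type_synonym reg_datum = "real measure \<times> real \<times> real"

definition reg_data_nonneg :: "reg_datum set" where
  "reg_data_nonneg = M2_nonneg \<times> UNIV \<times> {0..}"

definition reg_data :: "reg_datum set" where
  "reg_data = M2_plus \<times> UNIV \<times> {0..}"

definition F_reg :: "reg_datum \<Rightarrow> complex \<Rightarrow> complex" where
  "F_reg = (\<lambda>(lam, c\<^sub>0, c\<^sub>1) z. Q_reg lam z - (\<i> / pi) * (complex_of_real c\<^sub>0 + complex_of_real c\<^sub>1 * z))"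

text \<open>The case in which \<open>F_reg (lam, c\<^sub>0, c\<^sub>1) z\<close> is a positive multiple of \<open>\<i> / (z - a)\<close> for some real \<open>a\<close>.
  Its reciprocal is then affine in \<open>z\<close>, so that the dual measure is the zero measure.\<close>

definition degenerate :: "reg_datum \<Rightarrow> bool" where
  "degenerate = (\<lambda>(lam, c\<^sub>0, c\<^sub>1). c\<^sub>1 = 0 \<and> (\<exists>a m. m > 0
      \<and> lam = scale_measure (ennreal m) (return borel a) \<and> c\<^sub>0 = m * a / (1 + a\<^sup>2)))"

text \<open>A definite description; it is only meaningful where the unique existence of the dual datum
  holds. The dual measure is sought in \<open>M2_nonneg\<close>, see \<open>degenerate\<close>.\<close>

definition B_reg :: "reg_datum \<Rightarrow> reg_datum" where
  "B_reg t = (THE u. u \<in> reg_data_nonneg \<and> (\<forall>z. Im z > 0 \<longrightarrow> F_reg t z * F_reg u z = 1))"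

abbreviation circle :: "complex set" where
  "circle \<equiv> sphere 0 1"

abbreviation circle_borel :: "complex measure" where
  "circle_borel \<equiv> restrict_space borel circle"

definition M_plus_S1 :: "complex measure set" where
  "M_plus_S1 = {\<nu>. sets \<nu> = sets circle_borel \<and> finite_measure \<nu> \<and> \<nu> \<noteq> null_measure circle_borel}"

text \<open>The weak topology: the coarsest topology for which integration against every continuous
  function on the circle is continuous.\<close>

definition weak_topology_S1 :: "complex measure topology" where
  "weak_topology_S1 = topology_generated_by
     {{\<nu> \<in> M_plus_S1. (\<integral>x. f x \<partial>\<nu>) \<in> U} | (f :: complex \<Rightarrow> real) U. continuous_on circle f \<and> open U}"

definition measure_add :: "'a measure \<Rightarrow> 'a measure \<Rightarrow> 'a measure" where
  "measure_add M N = measure_of (space M) (sets M) (\<lambda>A. emeasure M A + emeasure N A)"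

definition cayley :: "complex \<Rightarrow> complex" where
  "cayley z = \<i> * (1 - z) / (1 + z)"

definition cayley_inv :: "complex \<Rightarrow> complex" where
  "cayley_inv w = (\<i> - w) / (\<i> + w)"

definition psi :: "real measure \<Rightarrow> complex measure" where
  "psi lam = distr (density lam (\<lambda>s. ennreal (1 / (pi * (1 + s\<^sup>2))))) circle_borel
     (\<lambda>s. cayley_inv (complex_of_real s))"

definition Psi_reg :: "reg_datum \<Rightarrow> complex measure \<times> real" where
  "Psi_reg = (\<lambda>(lam, c\<^sub>0, c\<^sub>1).
     (measure_add (psi lam) (scale_measure (ennreal (c\<^sub>1 / pi)) (return circle_borel (-1))), - c\<^sub>0 / pi))"

text \<open>The pullback of the product topology under \<open>Psi_reg\<close>, on a set \<open>S\<close> of data. Only those data enter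
  whose image lies in \<open>M_plus_S1 \<times> UNIV\<close>; for \<open>S = reg_data\<close> these are all, for
  \<open>S = reg_data_nonneg\<close> all but those with zero measure and \<open>c\<^sub>1 = 0\<close>.\<close>

definition reg_topology :: "reg_datum set \<Rightarrow> reg_datum topology" where
  "reg_topology S = pullback_topology S Psi_reg (prod_topology weak_topology_S1 euclideanreal)"

lemma sets_measure_add: "sets (measure_add M N) = sets M"
  by (simp add: measure_add_def sets.space_closed)

lemma emeasure_measure_add:
  assumes "sets N = sets M" "A \<in> sets M"
  shows "emeasure (measure_add M N) A = emeasure M A + emeasure N A"
proof (rule emeasure_measure_of[OF measure_add_def sets.space_closed])
  show "A \<in> sets (measure_add M N)"
    using assms by (simp add: sets_measure_add)
  show "positive (sets (measure_add M N)) (\<lambda>A. emeasure M A + emeasure N A)"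
    by (simp add: positive_def)
  show "countably_additive (sets (measure_add M N)) (\<lambda>A. emeasure M A + emeasure N A)"
    unfolding sets_measure_add
  proof (rule countably_additiveI)
    fix B :: "nat \<Rightarrow> 'a set"
    assume "range B \<subseteq> sets M" "disjoint_family B" "\<Union> (range B) \<in> sets M"
    then show "(\<Sum>i. emeasure M (B i) + emeasure N (B i)) = emeasure M (\<Union> (range B)) + emeasure N (\<Union> (range B))"
      using assms(1) by (simp add: suminf_add[symmetric] suminf_emeasure)
  qed
qed

lemma cayley_inverse:
  assumes "z \<noteq> -1"
  shows "cayley_inv (cayley z) = z"
proof -
  have nz: "1 + z \<noteq> 0"
    using assms by (metis add.inverse_unique)
  define c where "c = cayley z"
  have c: "c * (1 + z) = \<i> * (1 - z)"
    using nz by (simp add: c_def cayley_def)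
  have "\<i> - c = z * (\<i> + c)"
    using c by algebra
  moreover have "\<i> + c \<noteq> 0"
  proof
    assume "\<i> + c = 0"
    then have "c = - \<i>"
      by (simp add: add_eq_0_iff)
    with c have "\<i> * 2 = 0"
      by algebra
    then show False
      by simp
  qed
  ultimately have "cayley_inv c = z"
    unfolding cayley_inv_def by (metis nonzero_mult_div_cancel_right)
  then show ?thesis
    by (simp add: c_def)
qed

lemma norm_cayley_inv_of_real: "cayley_inv (complex_of_real s) \<in> circle"
proof -
  have "norm (\<i> - complex_of_real s) = norm (\<i> + complex_of_real s)"
    by (simp add: cmod_def)
  moreover have "\<i> + complex_of_real s \<noteq> 0"
    by (simp add: complex_eq_iff)
  ultimately show ?thesis
    by (simp add: cayley_inv_def norm_divide)
qed

end

theory Submission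
  imports Defs "HOL-Complex_Analysis.Complex_Analysis"
begin

text \<open>
  Under the Cayley transform the theorem becomes a statement about Herglotz transforms
  \<open>H(w) = \<integral> (\<zeta> + w) / (\<zeta> - w) d\<nu>(\<zeta>) + \<i> b\<close>
  of finite measures on the circle. If \<open>z = cayley w\<close> and \<open>s\<close> corresponds to \<open>\<zeta>\<close>, then
  \<open>(\<zeta> + w) / (\<zeta> - w) = \<i> (1 + s z) / (z - s)\<close>, which is the kernel of \<open>Q_reg\<close> multiplied by \<open>\<pi> (1 + s\<^sup>2)\<close>, while for
  \<open>\<zeta> = -1\<close>, the point at infinity, it is \<open>-\<i> z\<close>. Hence the affine terms of \<open>F_reg\<close> are absorbed in a point mass at \<open>-1\<close>
  and in the imaginary constant, and \<open>F_reg t (cayley w)\<close> is the Herglotz transform of \<open>Psi_reg t\<close> (\<open>F_reg_eq_herglotz\<close>).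
  Moreover \<open>Psi_reg\<close> is a bijection of \<open>reg_data_nonneg\<close> onto the pairs of a finite measure
  and a real number (\<open>Psi_inverse_Psi_reg\<close>, \<open>Psi_reg_Psi_inverse\<close>).

  A Herglotz transform of a nonzero measure has positive real part, hence so has its reciprocal, and by the
  Herglotz representation theorem (\<open>Herglotz_representation\<close>) the reciprocal is again a Herglotz
  transform. The Taylor coefficients of \<open>H\<close> at \<open>0\<close> are the moments of \<open>\<nu>\<close>, up to conjugation, a factor \<open>2\<close> and
  the constant \<open>\<i> b\<close>; since trigonometric polynomials are dense, they determine \<open>\<nu>\<close> and \<open>b\<close> (\<open>herglotz_unique\<close>).
  This gives existence and uniqueness of the dual datum.

  The other claims follow from uniqueness and from the Taylor coefficients. The dual measure vanishes exactly
  if the reciprocal of \<open>F_reg t\<close> is affine; then \<open>F_reg t\<close> is that of a point mass, and by uniqueness \<open>t\<close> itself is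
  degenerate (\<open>degenerate_iff_null_dual\<close>). The reflection \<open>s \<mapsto> -s\<close> maps dual pairs to dual
  pairs, so a reflection-invariant datum has an invariant dual (\<open>dual_reflect\<close>). For continuity, the
  coefficients of \<open>1 / H\<close> are given recursively by those of \<open>H\<close>, with division only by the coefficient of
  order \<open>0\<close>, which does not vanish. Weak convergence therefore passes to the moments of the dual, and from
  there to all continuous test functions by density (\<open>reciprocal_herglotz_tendsto\<close>).
\<close>

section \<open>Finite measures on the circle and their moments\<close>

text \<open>Unlike \<open>M_plus_S1\<close>, this contains the zero measure, so that \<open>Psi_reg\<close> is a bijection of all of
  \<open>reg_data_nonneg\<close> onto \<open>circle_measures \<times> UNIV\<close>.\<close>

definition circle_measures :: "complex measure set" where
  "circle_measures = {\<nu>. sets \<nu> = sets circle_borel \<and> finite_measure \<nu>}"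

lemma circle_measures_space: "\<nu> \<in> circle_measures \<Longrightarrow> space \<nu> = circle"
  using sets_eq_imp_space_eq[of \<nu> circle_borel] by (simp add: circle_measures_def space_restrict_space)

lemma continuous_imp_borel_measurable_circle:
  fixes f :: "complex \<Rightarrow> 'b::{banach, second_countable_topology}"
  assumes "\<nu> \<in> circle_measures" "continuous_on circle f"
  shows "f \<in> borel_measurable \<nu>"
proof -
  have "f \<in> borel_measurable circle_borel"
    using assms(2) by (rule borel_measurable_continuous_on_restrict)
  then show ?thesis
    using assms(1) measurable_cong_sets[of \<nu> circle_borel borel borel] unfolding circle_measures_def by blast
qed

lemma continuous_imp_integrable_circle:
  fixes f :: "complex \<Rightarrow> 'b::{banach, second_countable_topology}"
  assumes nu: "\<nu> \<in> circle_measures" and f: "continuous_on circle f"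
  shows "integrable \<nu> f"
proof -
  interpret finite_measure \<nu>
    using nu by (simp add: circle_measures_def)
  have "compact (f ` circle)"
    using f by (intro compact_continuous_image) auto
  then obtain B where B: "\<And>x. x \<in> circle \<Longrightarrow> norm (f x) \<le> B"
    by (metis bounded_iff compact_imp_bounded imageI)
  show ?thesis
    by (rule integrable_const_bound[of _ B])
       (use B nu f in \<open>auto simp: circle_measures_space intro!: continuous_imp_borel_measurable_circle\<close>)
qed

lemma circle_cnj_inverse: "\<zeta> \<in> circle \<Longrightarrow> cnj \<zeta> * \<zeta> = 1"
  by (simp add: complex_norm_square[symmetric] mult.commute)

text \<open>Negative frequencies are covered by taking real parts, since \<open>\<zeta>\<^sup>-\<^sup>1 = cnj \<zeta>\<close> on the circle.\<close>

inductive trig_polynomial :: "(complex \<Rightarrow> real) \<Rightarrow> bool" where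
  monomial: "trig_polynomial (\<lambda>\<zeta>. Re (c * \<zeta> ^ k))"
| add: "trig_polynomial p \<Longrightarrow> trig_polynomial q \<Longrightarrow> trig_polynomial (\<lambda>\<zeta>. p \<zeta> + q \<zeta>)"

text \<open>From \<open>2 Re a Re b = Re (a b) + Re (cnj a b)\<close> and \<open>cnj \<zeta> = 1 / \<zeta>\<close>. This makes the trigonometric
  polynomials an algebra on the circle.\<close>

lemma trig_monomial_product:
  assumes "\<zeta> \<in> circle" "k \<le> l"
  shows "Re (c * \<zeta> ^ k) * Re (d * \<zeta> ^ l) = Re (c * d / 2 * \<zeta> ^ (k + l)) + Re (cnj c * d / 2 * \<zeta> ^ (l - k))"
proof -
  have z: "cnj \<zeta> * \<zeta> = 1"
    using assms(1) by (rule circle_cnj_inverse)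
  have pw: "cnj (\<zeta> ^ k) * \<zeta> ^ l = \<zeta> ^ (l - k)"
  proof -
    have "\<zeta> ^ l = \<zeta> ^ k * \<zeta> ^ (l - k)"
      using assms(2) by (simp flip: power_add)
    moreover have "cnj (\<zeta> ^ k) * \<zeta> ^ k = 1"
      using z by (simp flip: power_mult_distrib)
    ultimately show ?thesis
      by (metis mult.assoc mult_1)
  qed
  have gen: "Re a * Re b = Re (a * b / 2) + Re (cnj a * b / 2)" for a b
    by (simp add: field_simps)
  have "cnj (c * \<zeta> ^ k) * (d * \<zeta> ^ l) / 2 = cnj c * d / 2 * (cnj (\<zeta> ^ k) * \<zeta> ^ l)"
    by simp
  also have "\<dots> = cnj c * d / 2 * \<zeta> ^ (l - k)"
    by (simp only: pw)
  finally have "cnj (c * \<zeta> ^ k) * (d * \<zeta> ^ l) / 2 = cnj c * d / 2 * \<zeta> ^ (l - k)" .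
  moreover have "(c * \<zeta> ^ k) * (d * \<zeta> ^ l) / 2 = c * d / 2 * \<zeta> ^ (k + l)"
    by (simp add: power_add)
  ultimately show ?thesis
    using gen[of "c * \<zeta> ^ k" "d * \<zeta> ^ l"] by (simp only:)
qed

lemma trig_polynomial_mult:
  assumes "trig_polynomial p" "trig_polynomial q"
  shows "\<exists>r. trig_polynomial r \<and> (\<forall>\<zeta>\<in>circle. p \<zeta> * q \<zeta> = r \<zeta>)"
  using assms(1)
proof induction
  case (monomial c k)
  show ?case
    using assms(2)
  proof induction
    case (monomial d l)
    show ?case
    proof (cases "k \<le> l")
      case True
      then have "\<forall>\<zeta>\<in>circle. Re (c * \<zeta> ^ k) * Re (d * \<zeta> ^ l)
          = Re (c * d / 2 * \<zeta> ^ (k + l)) + Re (cnj c * d / 2 * \<zeta> ^ (l - k))"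
        using trig_monomial_product by blast
      moreover have "trig_polynomial (\<lambda>\<zeta>. Re (c * d / 2 * \<zeta> ^ (k + l)) + Re (cnj c * d / 2 * \<zeta> ^ (l - k)))"
        by (intro trig_polynomial.intros)
      ultimately show ?thesis
        by blast
    next
      case False
      then have "Re (c * \<zeta> ^ k) * Re (d * \<zeta> ^ l)
          = Re (d * c / 2 * \<zeta> ^ (l + k)) + Re (cnj d * c / 2 * \<zeta> ^ (k - l))" if "\<zeta> \<in> circle" for \<zeta>
        using trig_monomial_product[OF that, of l k d c] by (simp only: mult.commute[of "Re (c * \<zeta> ^ k)"] nat_le_linear)
      moreover have "trig_polynomial (\<lambda>\<zeta>. Re (d * c / 2 * \<zeta> ^ (l + k)) + Re (cnj d * c / 2 * \<zeta> ^ (k - l)))"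
        by (intro trig_polynomial.intros)
      ultimately show ?thesis
        by blast
    qed
  next
    case (add q1 q2)
    then obtain r1 r2 where "trig_polynomial r1" "trig_polynomial r2"
      "\<forall>\<zeta>\<in>circle. Re (c * \<zeta> ^ k) * q1 \<zeta> = r1 \<zeta>" "\<forall>\<zeta>\<in>circle. Re (c * \<zeta> ^ k) * q2 \<zeta> = r2 \<zeta>"
      by blast
    then show ?case
      by (intro exI[of _ "\<lambda>\<zeta>. r1 \<zeta> + r2 \<zeta>"]) (auto simp: distrib_left intro: trig_polynomial.add)
  qed
next
  case (add p1 p2)
  then obtain r1 r2 where "trig_polynomial r1" "trig_polynomial r2"
    "\<forall>\<zeta>\<in>circle. p1 \<zeta> * q \<zeta> = r1 \<zeta>" "\<forall>\<zeta>\<in>circle. p2 \<zeta> * q \<zeta> = r2 \<zeta>"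
    by blast
  then show ?case
    by (intro exI[of _ "\<lambda>\<zeta>. r1 \<zeta> + r2 \<zeta>"]) (auto simp: distrib_right intro: trig_polynomial.add)
qed

lemma real_polynomial_on_circle_trig:
  fixes g :: "complex \<Rightarrow> real"
  assumes "real_polynomial_function g"
  shows "\<exists>p. trig_polynomial p \<and> (\<forall>\<zeta>\<in>circle. g \<zeta> = p \<zeta>)"
  using assms
proof induction
  case (linear f)
  have "f \<zeta> = Re (Complex (f 1) (- f \<i>) * \<zeta> ^ 1)" for \<zeta>
  proof -
    have "f (Re \<zeta> *\<^sub>R 1 + Im \<zeta> *\<^sub>R \<i>) = Re \<zeta> * f 1 + Im \<zeta> * f \<i>"
      using bounded_linear.linear[OF linear] by (simp add: linear_add linear_scale)
    moreover have "Re \<zeta> *\<^sub>R 1 + Im \<zeta> *\<^sub>R \<i> = \<zeta>"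
      by (simp add: complex_eq_iff)
    ultimately show ?thesis
      by simp
  qed
  then show ?case
    using trig_polynomial.monomial[of "Complex (f 1) (- f \<i>)" 1] by blast
next
  case (const c)
  then show ?case
    using trig_polynomial.monomial[of "of_real c" 0] by (intro exI[of _ "\<lambda>\<zeta>. Re (of_real c * \<zeta> ^ 0)"]) auto
next
  case (add f g)
  then obtain p q where "trig_polynomial p" "trig_polynomial q" "\<forall>\<zeta>\<in>circle. f \<zeta> = p \<zeta>" "\<forall>\<zeta>\<in>circle. g \<zeta> = q \<zeta>"
    by blast
  then show ?case
    by (intro exI[of _ "\<lambda>\<zeta>. p \<zeta> + q \<zeta>"]) (auto intro: trig_polynomial.add)
next
  case (mult f g)
  then obtain p q where "trig_polynomial p" "trig_polynomial q" "\<forall>\<zeta>\<in>circle. f \<zeta> = p \<zeta>" "\<forall>\<zeta>\<in>circle. g \<zeta> = q \<zeta>"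
    by blast
  moreover from this obtain r where "trig_polynomial r" "\<forall>\<zeta>\<in>circle. p \<zeta> * q \<zeta> = r \<zeta>"
    using trig_polynomial_mult by blast
  ultimately show ?case
    by (intro exI[of _ r]) (simp del: mem_sphere_0)
qed

text \<open>The theorem of Stone and Weierstrass gives an approximation by a real polynomial in \<open>Re \<zeta>\<close> and
  \<open>Im \<zeta>\<close>, which on the circle is a trigonometric polynomial.\<close>

lemma trig_polynomial_dense:
  assumes "continuous_on circle f" "e > 0"
  obtains p where "trig_polynomial p" "\<And>\<zeta>. \<zeta> \<in> circle \<Longrightarrow> \<bar>f \<zeta> - p \<zeta>\<bar> < e"
proof -
  obtain g where g: "real_polynomial_function g" "\<And>\<zeta>. \<zeta> \<in> circle \<Longrightarrow> \<bar>f \<zeta> - g \<zeta>\<bar> < e"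
    using Stone_Weierstrass_real_polynomial_function[OF compact_sphere assms] by blast
  obtain p where p: "trig_polynomial p" "\<forall>\<zeta>\<in>circle. g \<zeta> = p \<zeta>"
    using real_polynomial_on_circle_trig[OF g(1)] by blast
  show ?thesis
    using p(2) g(2) by (intro that[OF p(1)]) (simp del: mem_sphere_0)
qed

lemma trig_polynomial_continuous: "trig_polynomial p \<Longrightarrow> continuous_on A p"
proof (induction rule: trig_polynomial.induct)
  case (monomial c k)
  show ?case
    by (intro continuous_intros)
qed (intro continuous_on_add)

definition moment :: "complex measure \<Rightarrow> nat \<Rightarrow> complex" where
  "moment \<nu> k = (\<integral>\<zeta>. \<zeta> ^ k \<partial>\<nu>)"

lemma moment_0: "moment \<nu> 0 = measure \<nu> (space \<nu>)"
  by (simp add: moment_def scaleR_conv_of_real)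

lemma integral_trig_monomial:
  assumes "\<nu> \<in> circle_measures"
  shows "(\<integral>\<zeta>. Re (c * \<zeta> ^ k) \<partial>\<nu>) = Re (c * moment \<nu> k)"
proof -
  have "integrable \<nu> (\<lambda>\<zeta>. c * \<zeta> ^ k)"
    by (intro continuous_imp_integrable_circle assms continuous_intros)
  then have "(\<integral>\<zeta>. Re (c * \<zeta> ^ k) \<partial>\<nu>) = Re (\<integral>\<zeta>. c * \<zeta> ^ k \<partial>\<nu>)"
    by (rule integral_Re)
  then show ?thesis
    by (simp only: moment_def integral_mult_right_zero)
qed

lemma integral_circle_approx:
  fixes f p :: "complex \<Rightarrow> real"
  assumes nu: "\<nu> \<in> circle_measures" and f: "continuous_on circle f" and p: "continuous_on circle p"
    and le: "\<And>\<zeta>. \<zeta> \<in> circle \<Longrightarrow> \<bar>f \<zeta> - p \<zeta>\<bar> \<le> e"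
  shows "\<bar>(\<integral>\<zeta>. f \<zeta> \<partial>\<nu>) - (\<integral>\<zeta>. p \<zeta> \<partial>\<nu>)\<bar> \<le> e * measure \<nu> (space \<nu>)"
proof -
  interpret finite_measure \<nu>
    using nu by (simp add: circle_measures_def)
  note i = continuous_imp_integrable_circle[OF nu f] continuous_imp_integrable_circle[OF nu p]
  have "\<bar>(\<integral>\<zeta>. f \<zeta> \<partial>\<nu>) - (\<integral>\<zeta>. p \<zeta> \<partial>\<nu>)\<bar> = \<bar>\<integral>\<zeta>. f \<zeta> - p \<zeta> \<partial>\<nu>\<bar>"
    using i by simp
  also have "\<dots> \<le> (\<integral>\<zeta>. \<bar>f \<zeta> - p \<zeta>\<bar> \<partial>\<nu>)"
    by (rule integral_abs_bound)
  also have "\<dots> \<le> (\<integral>\<zeta>. e \<partial>\<nu>)"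
    using i le nu by (intro integral_mono) (auto simp: circle_measures_space)
  finally show ?thesis
    by (simp add: mult.commute)
qed

lemma moments_determine_integrals:
  fixes f :: "complex \<Rightarrow> real"
  assumes nu: "\<nu> \<in> circle_measures" "\<nu>' \<in> circle_measures" and eq: "\<And>k. moment \<nu> k = moment \<nu>' k"
    and f: "continuous_on circle f"
  shows "(\<integral>\<zeta>. f \<zeta> \<partial>\<nu>) = (\<integral>\<zeta>. f \<zeta> \<partial>\<nu>')"
proof -
  define m where "m = measure \<nu> (space \<nu>)"
  have m': "measure \<nu>' (space \<nu>') = m"
    using eq[of 0] by (simp add: moment_0 m_def)
  have trig: "(\<integral>\<zeta>. p \<zeta> \<partial>\<nu>) = (\<integral>\<zeta>. p \<zeta> \<partial>\<nu>')" if "trig_polynomial p" for p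
    using that
  proof induction
    case (monomial c k)
    then show ?case
      by (simp add: integral_trig_monomial nu eq del: times_complex.sel)
  next
    case (add p q)
    then show ?case
      using nu by (simp add: continuous_imp_integrable_circle trig_polynomial_continuous)
  qed
  have "\<bar>(\<integral>\<zeta>. f \<zeta> \<partial>\<nu>) - (\<integral>\<zeta>. f \<zeta> \<partial>\<nu>')\<bar> \<le> 0 + e" if e: "e > 0" for e
  proof -
    have m0: "m \<ge> 0"
      by (simp add: m_def)
    define d where "d = e / (2 * (m + 1))"
    have d: "d > 0" "2 * (d * m) \<le> e"
      using e m0 mult_left_mono[of m "m + 1" e] by (simp_all add: d_def divide_le_eq)
    obtain p where p: "trig_polynomial p" "\<And>\<zeta>. \<zeta> \<in> circle \<Longrightarrow> \<bar>f \<zeta> - p \<zeta>\<bar> < d"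
      using trig_polynomial_dense[OF f d(1)] by blast
    have "\<bar>(\<integral>\<zeta>. f \<zeta> \<partial>\<nu>) - (\<integral>\<zeta>. p \<zeta> \<partial>\<nu>)\<bar> \<le> d * m" "\<bar>(\<integral>\<zeta>. f \<zeta> \<partial>\<nu>') - (\<integral>\<zeta>. p \<zeta> \<partial>\<nu>')\<bar> \<le> d * m"
      using integral_circle_approx[OF nu(1) f trig_polynomial_continuous[OF p(1)] less_imp_le[OF p(2)]]
        integral_circle_approx[OF nu(2) f trig_polynomial_continuous[OF p(1)] less_imp_le[OF p(2)]]
      by (simp_all only: m_def m')
    with trig[OF p(1)] d(2) show ?thesis
      by linarith
  qed
  then have "\<bar>(\<integral>\<zeta>. f \<zeta> \<partial>\<nu>) - (\<integral>\<zeta>. f \<zeta> \<partial>\<nu>')\<bar> \<le> 0"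
    by (rule field_le_epsilon)
  then show ?thesis
    by simp
qed

text \<open>The indicator of a closed set \<open>C\<close> is the limit of the continuous functions
  \<open>max 0 (1 - n dist(\<zeta>, C))\<close>, so the measures agree on closed sets, which are stable under intersection and generate the
  Borel sets.\<close>

lemma integrals_determine_circle_measure:
  assumes nu: "\<nu> \<in> circle_measures" "\<nu>' \<in> circle_measures"
    and eq: "\<And>f :: complex \<Rightarrow> real. continuous_on circle f \<Longrightarrow> (\<integral>\<zeta>. f \<zeta> \<partial>\<nu>) = (\<integral>\<zeta>. f \<zeta> \<partial>\<nu>')"
  shows "\<nu> = \<nu>'"
proof -
  interpret nu: finite_measure \<nu>
    using nu by (simp add: circle_measures_def)
  interpret nu': finite_measure \<nu>'
    using nu by (simp add: circle_measures_def)
  have lim: "(\<lambda>n. \<integral>\<zeta>. max 0 (1 - real n * infdist \<zeta> C) \<partial>\<rho>) \<longlonglongrightarrow> measure \<rho> C"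
    if rho: "\<rho> \<in> circle_measures" and C: "closed C" "C \<subseteq> circle" "C \<noteq> {}" for \<rho> C
  proof -
    interpret finite_measure \<rho>
      using rho by (simp add: circle_measures_def)
    have mC: "C \<in> sets \<rho>"
      using rho C by (auto simp: circle_measures_def sets_restrict_space image_iff)
    have "(\<lambda>n. \<integral>\<zeta>. max 0 (1 - real n * infdist \<zeta> C) \<partial>\<rho>) \<longlonglongrightarrow> (\<integral>\<zeta>. indicator C \<zeta> \<partial>\<rho>)"
    proof (rule integral_dominated_convergence[where w = "\<lambda>_. 1"])
      show "(\<lambda>\<zeta>. max 0 (1 - real n * infdist \<zeta> C)) \<in> borel_measurable \<rho>" for n
        by (intro continuous_imp_borel_measurable_circle rho continuous_intros continuous_on_infdist)
      show "AE \<zeta> in \<rho>. (\<lambda>n. max 0 (1 - real n * infdist \<zeta> C)) \<longlonglongrightarrow> indicator C \<zeta>"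
      proof (rule AE_I2)
        fix \<zeta>
        show "(\<lambda>n. max 0 (1 - real n * infdist \<zeta> C)) \<longlonglongrightarrow> indicator C \<zeta>"
        proof (cases "\<zeta> \<in> C")
          case True
          then show ?thesis
            by simp
        next
          case False
          then have pos: "infdist \<zeta> C > 0"
            using C by (simp add: infdist_pos_not_in_closed)
          obtain N where N: "1 / infdist \<zeta> C < real N"
            using reals_Archimedean2 by blast
          have "max 0 (1 - real n * infdist \<zeta> C) = 0" if "n \<ge> N" for n
          proof -
            have "1 / infdist \<zeta> C < real n"
              using N that by linarith
            then show ?thesis
              using pos by (simp add: field_simps)
          qed
          then have "eventually (\<lambda>n. max 0 (1 - real n * infdist \<zeta> C) = 0) sequentially"
            by (auto simp: eventually_sequentially)
          then show ?thesis
            using False by (simp add: tendsto_eventually)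
        qed
      qed
    qed (use mC in \<open>auto simp: infdist_nonneg\<close>)
    then show ?thesis
      using mC by simp
  qed
  have closed_eq: "emeasure \<nu> C = emeasure \<nu>' C" if C: "closed C" "C \<subseteq> circle" for C
  proof (cases "C = {}")
    case False
    have "(\<integral>\<zeta>. max 0 (1 - real n * infdist \<zeta> C) \<partial>\<nu>) = (\<integral>\<zeta>. max 0 (1 - real n * infdist \<zeta> C) \<partial>\<nu>')" for n
      by (intro eq continuous_intros continuous_on_infdist)
    then have "measure \<nu> C = measure \<nu>' C"
      using lim[OF nu(1) C False] lim[OF nu(2) C False] LIMSEQ_unique by auto
    then show ?thesis
      by (simp add: nu.emeasure_eq_measure nu'.emeasure_eq_measure)
  qed simp
  have gen: "sets circle_borel = sigma_sets circle {C. closed C \<and> C \<subseteq> circle}"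
  proof -
    have "sets circle_borel = (\<inter>) circle ` sigma_sets UNIV (Collect closed)"
      by (simp add: sets_restrict_space borel_eq_closed)
    also have "\<dots> = sigma_sets circle ((\<inter>) circle ` Collect closed)"
    proof (rule sigma_sets_Int)
      have "circle \<in> sets (borel :: complex measure)"
        by simp
      then show "circle \<in> sigma_sets UNIV (Collect closed)"
        by (simp add: borel_eq_closed)
    qed simp
    also have "(\<inter>) circle ` Collect closed = {C. closed C \<and> C \<subseteq> circle}"
    proof
      show "{C. closed C \<and> C \<subseteq> circle} \<subseteq> (\<inter>) circle ` Collect closed"
      proof
        fix C assume "C \<in> {C. closed C \<and> C \<subseteq> circle}"
        then have "C = circle \<inter> C" "C \<in> Collect closed"
          by auto
        then show "C \<in> (\<inter>) circle ` Collect closed"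
          by (rule image_eqI)
      qed
    qed (auto intro: closed_Int)
    finally show ?thesis .
  qed
  show ?thesis
  proof (rule measure_eqI_generator_eq[where E = "{C. closed C \<and> C \<subseteq> circle}" and \<Omega> = circle and A = "\<lambda>_. circle"])
    show "Int_stable {C. closed C \<and> C \<subseteq> circle}"
      by (auto simp: Int_stable_def)
    show "sets \<nu> = sigma_sets circle {C. closed C \<and> C \<subseteq> circle}"
      "sets \<nu>' = sigma_sets circle {C. closed C \<and> C \<subseteq> circle}"
      using nu by (simp_all only: circle_measures_def mem_Collect_eq gen)
    show "\<And>i. emeasure \<nu> circle \<noteq> \<infinity>"
      using nu.emeasure_finite by simp
    show "range (\<lambda>_. circle) \<subseteq> {C. closed C \<and> C \<subseteq> circle}"
      by (simp add: image_subset_iff)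
  qed (use closed_eq in blast)+
qed

lemma moments_determine_circle_measure:
  assumes "\<nu> \<in> circle_measures" "\<nu>' \<in> circle_measures" "\<And>k. moment \<nu> k = moment \<nu>' k"
  shows "\<nu> = \<nu>'"
  using assms by (intro integrals_determine_circle_measure moments_determine_integrals)

section \<open>Herglotz transforms\<close>

definition herglotz_kernel :: "complex \<Rightarrow> complex \<Rightarrow> complex" where
  "herglotz_kernel w \<zeta> = (\<zeta> + w) / (\<zeta> - w)"

definition herglotz :: "complex measure \<times> real \<Rightarrow> complex \<Rightarrow> complex" where
  "herglotz = (\<lambda>(\<nu>, b) w. (\<integral>\<zeta>. herglotz_kernel w \<zeta> \<partial>\<nu>) + \<i> * of_real b)"

text \<open>The Taylor coefficients of \<open>herglotz (\<nu>, b)\<close> at \<open>0\<close>, see \<open>herglotz_sums\<close>.\<close>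

definition herglotz_coeff :: "complex measure \<times> real \<Rightarrow> nat \<Rightarrow> complex" where
  "herglotz_coeff = (\<lambda>(\<nu>, b) n. if n = 0 then moment \<nu> 0 + \<i> * of_real b else 2 * cnj (moment \<nu> n))"

lemma herglotz_kernel_continuous:
  assumes "norm w < 1"
  shows "continuous_on circle (herglotz_kernel w)"
proof -
  have "\<zeta> - w \<noteq> 0" if "\<zeta> \<in> circle" for \<zeta>
    using that assms by auto
  then show ?thesis
    unfolding herglotz_kernel_def by (intro continuous_intros) blast
qed

lemma herglotz_kernel_integrable:
  "\<nu> \<in> circle_measures \<Longrightarrow> norm w < 1 \<Longrightarrow> integrable \<nu> (herglotz_kernel w)"
  by (intro continuous_imp_integrable_circle herglotz_kernel_continuous)

text \<open>A geometric series: with \<open>q = w cnj \<zeta>\<close> the kernel is \<open>(1 + q) / (1 - q) = 2 / (1 - q) - 1\<close>.\<close>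

lemma herglotz_kernel_sums:
  assumes "\<zeta> \<in> circle" "norm w < 1"
  shows "(\<lambda>n. (if n = 0 then 1 else 2) * (w * cnj \<zeta>) ^ n) sums herglotz_kernel w \<zeta>"
proof -
  define q where "q = w * cnj \<zeta>"
  have q: "norm q < 1"
    using assms by (simp add: q_def norm_mult)
  have nz: "\<zeta> - w \<noteq> 0" "1 - q \<noteq> 0"
    using assms q by auto
  have one: "cnj \<zeta> * \<zeta> = 1"
    using assms(1) by (rule circle_cnj_inverse)
  have "(2 - (1 - q)) * (\<zeta> - w) = (\<zeta> + w) * (1 - q)"
    using one unfolding q_def by algebra
  then have eq: "2 * (1 / (1 - q)) - 1 = herglotz_kernel w \<zeta>"
    using nz by (simp add: herglotz_kernel_def field_simps)
  have "(\<lambda>n. 2 * q ^ n - (if n = 0 then 1 else 0)) sums (2 * (1 / (1 - q)) - 1)"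
    by (intro sums_diff sums_mult geometric_sums q) (use sums_single[of 0 "\<lambda>_. 1 :: complex"] in simp)
  also have "(\<lambda>n. 2 * q ^ n - (if n = 0 then 1 else 0)) = (\<lambda>n. (if n = 0 then 1 else 2) * q ^ n)"
    by auto
  finally show ?thesis
    unfolding eq by (simp only: q_def)
qed

lemma herglotz_sums:
  assumes nu: "\<nu> \<in> circle_measures" and w: "norm w < 1"
  shows "(\<lambda>n. herglotz_coeff (\<nu>, b) n * w ^ n) sums herglotz (\<nu>, b) w"
proof -
  interpret finite_measure \<nu>
    using nu by (simp add: circle_measures_def)
  define f where "f n \<zeta> = (if n = 0 then 1 else 2) * (w * cnj \<zeta>) ^ n" for n :: nat and \<zeta>
  have int: "integrable \<nu> (f n)" for n
    unfolding f_def by (intro continuous_imp_integrable_circle nu continuous_intros)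
  have norm_f: "norm (f n \<zeta>) \<le> 2 * norm w ^ n" if "\<zeta> \<in> circle" for n \<zeta>
    using that by (simp add: f_def norm_mult norm_power)
  have geo: "summable (\<lambda>n. c * norm w ^ n)" for c
    using w by (intro summable_mult summable_geometric) simp
  have "(\<lambda>n. \<integral>\<zeta>. f n \<zeta> \<partial>\<nu>) sums (\<integral>\<zeta>. (\<Sum>n. f n \<zeta>) \<partial>\<nu>)"
  proof (rule sums_integral[OF int])
    show "AE \<zeta> in \<nu>. summable (\<lambda>n. norm (f n \<zeta>))"
    proof (rule AE_I2)
      fix \<zeta> assume "\<zeta> \<in> space \<nu>"
      then show "summable (\<lambda>n. norm (f n \<zeta>))"
        using norm_f by (intro summable_comparison_test'[OF geo[of 2], of 0]) (simp add: circle_measures_space[OF nu])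
    qed
    have "(\<integral>\<zeta>. norm (f n \<zeta>) \<partial>\<nu>) \<le> 2 * measure \<nu> (space \<nu>) * norm w ^ n" for n
    proof -
      have "(\<integral>\<zeta>. norm (f n \<zeta>) \<partial>\<nu>) \<le> (\<integral>\<zeta>. 2 * norm w ^ n \<partial>\<nu>)"
        using norm_f int by (intro integral_mono integrable_norm) (simp_all add: circle_measures_space[OF nu])
      then show ?thesis
        by (simp add: mult_ac)
    qed
    then show "summable (\<lambda>n. \<integral>\<zeta>. norm (f n \<zeta>) \<partial>\<nu>)"
      by (intro summable_comparison_test'[OF geo[of "2 * measure \<nu> (space \<nu>)"], of 0]) simp
  qed
  moreover have "(\<integral>\<zeta>. (\<Sum>n. f n \<zeta>) \<partial>\<nu>) = (\<integral>\<zeta>. herglotz_kernel w \<zeta> \<partial>\<nu>)"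
    using herglotz_kernel_sums[OF _ w] unfolding f_def
    by (intro Bochner_Integration.integral_cong refl) (simp add: circle_measures_space[OF nu] sums_iff del: mem_sphere_0)
  moreover have "(\<integral>\<zeta>. f n \<zeta> \<partial>\<nu>) = (if n = 0 then 1 else 2) * cnj (moment \<nu> n) * w ^ n" for n
  proof -
    have "(\<integral>\<zeta>. f n \<zeta> \<partial>\<nu>) = (\<integral>\<zeta>. ((if n = 0 then 1 else 2) * w ^ n) * cnj (\<zeta> ^ n) \<partial>\<nu>)"
      by (simp add: f_def power_mult_distrib mult_ac)
    also have "\<dots> = ((if n = 0 then 1 else 2) * w ^ n) * cnj (moment \<nu> n)"
      unfolding moment_def integral_mult_right_zero Bochner_Integration.integral_cnj by (rule refl)
    finally show ?thesis
      by (simp only: mult_ac)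
  qed
  ultimately have "(\<lambda>n. (if n = 0 then 1 else 2) * cnj (moment \<nu> n) * w ^ n) sums (\<integral>\<zeta>. herglotz_kernel w \<zeta> \<partial>\<nu>)"
    by (simp only:)
  then have "(\<lambda>n. (if n = 0 then 1 else 2) * cnj (moment \<nu> n) * w ^ n + (if n = 0 then \<i> * of_real b else 0)) sums
      ((\<integral>\<zeta>. herglotz_kernel w \<zeta> \<partial>\<nu>) + \<i> * of_real b)"
    by (rule sums_add) (use sums_single[of 0 "\<lambda>_. \<i> * of_real b"] in simp)
  also have "(\<lambda>n. (if n = 0 then 1 else 2) * cnj (moment \<nu> n) * w ^ n + (if n = 0 then \<i> * of_real b else 0))
      = (\<lambda>n. herglotz_coeff (\<nu>, b) n * w ^ n)"
    by (auto simp: herglotz_coeff_def moment_0)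
  finally show ?thesis
    by (simp add: herglotz_def)
qed

definition herglotz_fps :: "complex measure \<times> real \<Rightarrow> complex fps" where
  "herglotz_fps p = Abs_fps (herglotz_coeff p)"

lemma herglotz_has_fps_expansion:
  assumes "\<nu> \<in> circle_measures"
  shows "herglotz (\<nu>, b) has_fps_expansion herglotz_fps (\<nu>, b)"
proof (rule has_fps_expansionI)
  have "eventually (\<lambda>u :: complex. u \<in> ball 0 1) (nhds 0)"
    by (intro eventually_nhds_in_open) auto
  then show "\<forall>\<^sub>F u in nhds 0. (\<lambda>n. fps_nth (herglotz_fps (\<nu>, b)) n * u ^ n) sums herglotz (\<nu>, b) u"
    by eventually_elim (simp add: herglotz_fps_def herglotz_sums assms)
qed

lemma herglotz_holomorphic:
  assumes "\<nu> \<in> circle_measures"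
  shows "herglotz (\<nu>, b) holomorphic_on ball 0 1"
  by (rule power_series_holomorphic[of 0 1 "herglotz_coeff (\<nu>, b)"]) (simp add: herglotz_sums assms)

lemma herglotz_coeff_determines:
  assumes "herglotz_coeff (\<nu>, b) = herglotz_coeff (\<nu>', b')"
  shows "b = b'" "moment \<nu> k = moment \<nu>' k"
proof -
  have k: "herglotz_coeff (\<nu>, b) k = herglotz_coeff (\<nu>', b') k" for k
    using assms by simp
  show "b = b'"
    using arg_cong[OF k[of 0], of Im] by (simp add: herglotz_coeff_def moment_0)
  then show "moment \<nu> k = moment \<nu>' k"
    using k[of k] by (auto simp: herglotz_coeff_def split: if_splits)
qed

text \<open>The Taylor coefficients contain all moments of the measure, and \<open>b\<close> as the imaginary part of the one of order \<open>0\<close>.\<close>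

lemma herglotz_unique:
  assumes nu: "\<nu> \<in> circle_measures" "\<nu>' \<in> circle_measures"
    and eq: "\<And>w. norm w < 1 \<Longrightarrow> herglotz (\<nu>, b) w = herglotz (\<nu>', b') w"
  shows "\<nu> = \<nu>' \<and> b = b'"
proof -
  have "eventually (\<lambda>u :: complex. u \<in> ball 0 1) (nhds 0)"
    by (intro eventually_nhds_in_open) auto
  then have "eventually (\<lambda>w. herglotz (\<nu>', b') w = herglotz (\<nu>, b) w) (nhds 0)"
    by eventually_elim (simp add: eq)
  then have "herglotz (\<nu>, b) has_fps_expansion herglotz_fps (\<nu>', b')"
    using herglotz_has_fps_expansion[OF nu(2), of b'] has_fps_expansion_cong by blast
  then have "herglotz_fps (\<nu>, b) = herglotz_fps (\<nu>', b')"
    using herglotz_has_fps_expansion[OF nu(1), of b] fps_expansion_unique_complex by blast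
  then have c: "herglotz_coeff (\<nu>, b) = herglotz_coeff (\<nu>', b')"
    by (simp add: herglotz_fps_def Abs_fps_inject)
  then show ?thesis
    using herglotz_coeff_determines[OF c] moments_determine_circle_measure[OF nu] by blast
qed

lemma Re_herglotz_kernel:
  assumes z: "\<zeta> \<in> circle" and w: "norm w < 1"
  shows "Re (herglotz_kernel w \<zeta>) = (1 - (norm w)\<^sup>2) / (norm (\<zeta> - w))\<^sup>2"
proof -
  have "herglotz_kernel w \<zeta> = (\<zeta> + w) * cnj (\<zeta> - w) / of_real ((norm (\<zeta> - w))\<^sup>2)"
    by (simp add: herglotz_kernel_def complex_div_cnj[of "\<zeta> + w"])
  then have "Re (herglotz_kernel w \<zeta>) = Re ((\<zeta> + w) * cnj (\<zeta> - w)) / (norm (\<zeta> - w))\<^sup>2"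
    by (simp only: Re_divide_of_real)
  also have "Re ((\<zeta> + w) * cnj (\<zeta> - w)) = (norm \<zeta>)\<^sup>2 - (norm w)\<^sup>2"
    unfolding cmod_power2 by (simp add: algebra_simps power2_eq_square)
  finally show ?thesis
    using z by simp
qed

text \<open>The real part of the kernel is the Poisson kernel
  \<open>(1 - \<bar>w\<bar>\<^sup>2) / \<bar>\<zeta> - w\<bar>\<^sup>2\<close>, and \<open>\<bar>\<zeta> - w\<bar> \<le> 2\<close>.\<close>

lemma Re_herglotz_ge:
  assumes nu: "\<nu> \<in> circle_measures" and w: "norm w < 1"
  shows "Re (herglotz (\<nu>, b) w) \<ge> (1 - (norm w)\<^sup>2) / 4 * measure \<nu> (space \<nu>)"
proof -
  interpret finite_measure \<nu>
    using nu by (simp add: circle_measures_def)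
  have int: "integrable \<nu> (herglotz_kernel w)"
    using nu w by (rule herglotz_kernel_integrable)
  have w1: "1 - (norm w)\<^sup>2 \<ge> 0"
    using w by (simp add: abs_square_le_1)
  have bound: "(1 - (norm w)\<^sup>2) / 4 \<le> Re (herglotz_kernel w \<zeta>)" if z: "\<zeta> \<in> circle" for \<zeta>
  proof -
    have "norm (\<zeta> - w) \<le> 2"
      using norm_triangle_ineq4[of \<zeta> w] z w by simp
    then have "(norm (\<zeta> - w))\<^sup>2 \<le> 2\<^sup>2"
      by (intro power_mono) auto
    moreover have "(norm (\<zeta> - w))\<^sup>2 > 0"
      using z w by auto
    ultimately show ?thesis
      unfolding Re_herglotz_kernel[OF z w] using w1 by (intro divide_left_mono) auto
  qed
  have "(\<integral>\<zeta>. (1 - (norm w)\<^sup>2) / 4 \<partial>\<nu>) \<le> (\<integral>\<zeta>. Re (herglotz_kernel w \<zeta>) \<partial>\<nu>)"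
    using int bound by (intro integral_mono integrable_Re) (simp_all add: circle_measures_space[OF nu])
  also have "\<dots> = Re (herglotz (\<nu>, b) w)"
    using int by (simp add: herglotz_def integral_Re)
  finally show ?thesis
    by (simp add: mult.commute)
qed

lemma circle_measure_mass_pos:
  assumes nu: "\<nu> \<in> circle_measures" and nz: "\<nu> \<noteq> null_measure circle_borel"
  shows "measure \<nu> (space \<nu>) > 0"
proof (rule ccontr)
  interpret finite_measure \<nu>
    using nu by (simp add: circle_measures_def)
  assume "\<not> measure \<nu> (space \<nu>) > 0"
  then have "measure \<nu> A = 0" for A
    using bounded_measure[of A] by (simp add: order_antisym)
  then have "\<nu> = null_measure circle_borel"
    using nu by (intro measure_eqI) (auto simp: circle_measures_def emeasure_eq_measure)
  with nz show False ..
qed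

lemma Re_herglotz_pos:
  assumes "\<nu> \<in> circle_measures" "\<nu> \<noteq> null_measure circle_borel" "norm w < 1"
  shows "Re (herglotz (\<nu>, b) w) > 0"
proof -
  have "1 - (norm w)\<^sup>2 > 0"
    using assms(3) by (simp add: abs_square_less_1)
  then have "0 < (1 - (norm w)\<^sup>2) / 4 * measure \<nu> (space \<nu>)"
    using circle_measure_mass_pos[OF assms(1,2)] by simp
  then show ?thesis
    using Re_herglotz_ge[OF assms(1,3), of b] by linarith
qed

section \<open>Integration against multiples and sums of measures\<close>

lemma scale_measure_eq_density: "scale_measure c M = density M (\<lambda>_. c)"
  by (rule measure_eqI) (simp_all add: emeasure_density_const)

lemma integral_scale_measure:
  fixes f :: "'a \<Rightarrow> 'b::{banach, second_countable_topology}"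
  assumes "c \<ge> 0" "f \<in> borel_measurable M"
  shows "integral\<^sup>L (scale_measure (ennreal c) M) f = c *\<^sub>R integral\<^sup>L M f"
  unfolding scale_measure_eq_density using assms by (subst integral_density) auto

text \<open>By monotone approximation with simple functions, starting from indicators.\<close>

lemma nn_integral_measure_add:
  assumes "sets N = sets M" "f \<in> borel_measurable M"
  shows "(\<integral>\<^sup>+ x. f x \<partial>measure_add M N) = (\<integral>\<^sup>+ x. f x \<partial>M) + (\<integral>\<^sup>+ x. f x \<partial>N)"
proof -
  have add_cong: "g \<in> borel_measurable (measure_add M N)" "g \<in> borel_measurable N"
    if "g \<in> borel_measurable M" for g :: "'a \<Rightarrow> ennreal"
    using that measurable_cong_sets[OF sets_measure_add[of M N] refl, of borel] measurable_cong_sets[OF assms(1) refl, of borel]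
    by blast+
  have spaces: "space (measure_add M N) = space M" "space N = space M"
    using assms(1) by (metis sets_eq_imp_space_eq sets_measure_add)+
  show ?thesis
    using assms(2)
  proof (induction rule: borel_measurable_induct)
    case (cong f g)
    have "(\<integral>\<^sup>+ x. f x \<partial>K) = (\<integral>\<^sup>+ x. g x \<partial>K)" if "space K = space M" for K
      using cong(3) that by (intro nn_integral_cong) simp
    note eq = this[OF spaces(1)] this[OF spaces(2)] this[OF refl]
    show ?case
      unfolding eq by (rule cong(4))
  next
    case (set A)
    then have "A \<in> sets N" "A \<in> sets (measure_add M N)"
      by (simp_all only: assms(1) sets_measure_add)
    then show ?case
      using set by (simp only: nn_integral_indicator emeasure_measure_add[OF assms(1)])
  next
    case (mult u c)
    then show ?case
      by (simp only: nn_integral_cmult[OF mult(2)] nn_integral_cmult[OF add_cong(1)[OF mult(2)]]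
          nn_integral_cmult[OF add_cong(2)[OF mult(2)]] distrib_left)
  next
    case (add u v)
    then show ?case
      by (simp only: nn_integral_add[OF add(1) add(3)] nn_integral_add[OF add_cong(1) add_cong(1), OF add(1) add(3)]
          nn_integral_add[OF add_cong(2) add_cong(2), OF add(1) add(3)] ac_simps)
  next
    case (seq U)
    have lim: "(\<integral>\<^sup>+ x. (SUP i. U i) x \<partial>K) = (SUP i. \<integral>\<^sup>+ x. U i x \<partial>K)"
      if "\<And>i. U i \<in> borel_measurable K" for K
      using nn_integral_monotone_convergence_SUP[OF \<open>incseq U\<close> that] by (simp add: image_comp)
    have "incseq (\<lambda>i. \<integral>\<^sup>+ x. U i x \<partial>K)" for K
      using \<open>incseq U\<close> by (auto simp: incseq_def le_fun_def intro!: nn_integral_mono)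
    note inc = this
    have meas: "U i \<in> borel_measurable M" for i
      using seq by blast
    have "(\<integral>\<^sup>+ x. (SUP i. U i) x \<partial>measure_add M N) = (SUP i. (\<integral>\<^sup>+ x. U i x \<partial>M) + (\<integral>\<^sup>+ x. U i x \<partial>N))"
      unfolding lim[OF add_cong(1)[OF meas]] using seq by (intro SUP_cong refl) blast
    also have "\<dots> = (SUP i. \<integral>\<^sup>+ x. U i x \<partial>M) + (SUP i. \<integral>\<^sup>+ x. U i x \<partial>N)"
      by (rule ennreal_SUP_add[OF inc inc])
    also have "\<dots> = (\<integral>\<^sup>+ x. (SUP i. U i) x \<partial>M) + (\<integral>\<^sup>+ x. (SUP i. U i) x \<partial>N)"
      by (simp only: lim[OF meas] lim[OF add_cong(2)[OF meas]])
    finally show ?case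
      using seq by simp
  qed
qed

lemma integral_measure_add_real:
  fixes f :: "'a \<Rightarrow> real"
  assumes sets: "sets N = sets M" and f: "integrable M f" "integrable N f"
  shows "integrable (measure_add M N) f"
    and "integral\<^sup>L (measure_add M N) f = integral\<^sup>L M f + integral\<^sup>L N f"
proof -
  have meas: "f \<in> borel_measurable M" "f \<in> borel_measurable (measure_add M N)"
    using f measurable_cong_sets[OF sets_measure_add[of M N] refl, of borel] by auto
  have fin: "(\<integral>\<^sup>+ x. ennreal (f x) \<partial>K) < \<infinity>" "(\<integral>\<^sup>+ x. ennreal (- f x) \<partial>K) < \<infinity>" if "integrable K f" for K
    using that by (auto simp: real_integrable_def less_top)
  have eq: "(\<integral>\<^sup>+ x. ennreal (f x) \<partial>measure_add M N) = (\<integral>\<^sup>+ x. ennreal (f x) \<partial>M) + (\<integral>\<^sup>+ x. ennreal (f x) \<partial>N)"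
    "(\<integral>\<^sup>+ x. ennreal (- f x) \<partial>measure_add M N) = (\<integral>\<^sup>+ x. ennreal (- f x) \<partial>M) + (\<integral>\<^sup>+ x. ennreal (- f x) \<partial>N)"
    using meas by (intro nn_integral_measure_add sets; simp)+
  show int: "integrable (measure_add M N) f"
    using fin[OF f(1)] fin[OF f(2)] meas(2) by (auto simp: real_integrable_def eq)
  show "integral\<^sup>L (measure_add M N) f = integral\<^sup>L M f + integral\<^sup>L N f"
    using fin[OF f(1)] fin[OF f(2)]
    unfolding real_lebesgue_integral_def[OF int] real_lebesgue_integral_def[OF f(1)] real_lebesgue_integral_def[OF f(2)] eq
    by (simp add: enn2real_plus)
qed

lemma integral_measure_add_complex:
  fixes f :: "'a \<Rightarrow> complex"
  assumes sets: "sets N = sets M" and f: "integrable M f" "integrable N f"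
  shows "integral\<^sup>L (measure_add M N) f = integral\<^sup>L M f + integral\<^sup>L N f"
proof -
  note Re = integral_measure_add_real[OF sets integrable_Re[OF f(1)] integrable_Re[OF f(2)]]
  note Im = integral_measure_add_real[OF sets integrable_Im[OF f(1)] integrable_Im[OF f(2)]]
  have "integrable (measure_add M N) (\<lambda>x. complex_of_real (Re (f x)) + \<i> * complex_of_real (Im (f x)))"
    by (intro Bochner_Integration.integrable_add integrable_mult_right integrable_of_real Re(1) Im(1))
  then have "integrable (measure_add M N) f"
    by (simp flip: complex_eq)
  then show ?thesis
    using Re(2) Im(2) by (intro complex_eqI) (simp_all only: integral_Re integral_Im f plus_complex.sel)
qed

section \<open>The Herglotz representation theorem\<close>

definition unit_turn :: "real \<Rightarrow> complex" where
  "unit_turn t = exp (2 * of_real pi * \<i> * of_real t)"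


lemma unit_turn_circle [simp]: "unit_turn t \<in> circle"
  by (simp add: unit_turn_def norm_exp_eq_Re)

lemma unit_turn_continuous [continuous_intros]:
  "continuous_on A unit_turn"
  unfolding unit_turn_def by (intro continuous_intros)

text \<open>Cauchy's integral formula on the unit circle, written as an integral over \<open>[0, 1]\<close> so that the
  limit of measures below can be taken on the real line.\<close>

lemma Cauchy_integral_unit_turn:
  assumes "h holomorphic_on cball 0 1" "norm w < 1"
  shows "((\<lambda>t. h (unit_turn t) * unit_turn t / (unit_turn t - w)) has_integral h w) {0..1}"
proof -
  have "((\<lambda>u. h u / (u - w)) has_contour_integral (2 * of_real pi * \<i> * h w)) (circlepath 0 1)"
    using assms by (intro Cauchy_integral_circlepath_simple) auto
  moreover have "vector_derivative (circlepath 0 1) (at t) = 2 * of_real pi * \<i> * unit_turn t" for t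
    using has_vector_derivative_circlepath[of 0 1 t UNIV] vector_derivative_at
    by (fastforce simp: unit_turn_def)
  ultimately have "((\<lambda>t. h (unit_turn t) / (unit_turn t - w) * (2 * of_real pi * \<i> * unit_turn t))
      has_integral (2 * of_real pi * \<i> * h w)) {0..1}"
    by (simp add: has_contour_integral circlepath unit_turn_def)
  then have "((\<lambda>t. (1 / (2 * of_real pi * \<i>)) * (h (unit_turn t) / (unit_turn t - w) * (2 * of_real pi * \<i> * unit_turn t)))
      has_integral (1 / (2 * of_real pi * \<i>)) * (2 * of_real pi * \<i> * h w)) {0..1}"
    by (rule has_integral_mult_right)
  then show ?thesis
    by (simp add: field_simps)
qed

lemma mean_value_unit_turn:
  assumes "h holomorphic_on cball 0 1"
  shows "((\<lambda>t. h (unit_turn t)) has_integral h 0) {0..1}"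
  using Cauchy_integral_unit_turn[OF assms, of 0] by (simp add: unit_turn_def)

text \<open>Write \<open>2 Re G = G + cnj G\<close>. Since the kernel equals \<open>2 \<zeta> / (\<zeta> - w) - 1\<close>, Cauchy's formula gives the integral \<open>2 G w - G 0\<close>
  for the first summand. The conjugate of the second is \<open>G\<close> times \<open>(1 + cnj w \<zeta>) / (1 - cnj w \<zeta>)\<close>
  on the circle, which is holomorphic on the disc, so its integral is the value \<open>G 0\<close> at the centre.\<close>

lemma Schwarz_integral_formula:
  assumes G: "G holomorphic_on cball 0 1" and w: "norm w < 1"
  shows "((\<lambda>t. of_real (Re (G (unit_turn t))) * herglotz_kernel w (unit_turn t))
           has_integral (G w - \<i> * of_real (Im (G 0)))) {0..1}"
proof -
  have nz: "\<zeta> - w \<noteq> 0" if "\<zeta> \<in> circle" for \<zeta>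
    using that w by auto
  have nz': "1 - cnj w * \<zeta> \<noteq> 0" if "norm \<zeta> \<le> 1" for \<zeta>
  proof
    assume "1 - cnj w * \<zeta> = 0"
    then have "norm (cnj w * \<zeta>) = 1"
      by (metis eq_iff_diff_eq_0 norm_one)
    moreover have "norm w * norm \<zeta> \<le> norm w * 1"
      using that by (intro mult_left_mono) auto
    ultimately show False
      using w by (simp add: norm_mult)
  qed
  have holo: "((\<lambda>t. 2 * (G (unit_turn t) * unit_turn t / (unit_turn t - w)) - G (unit_turn t)) has_integral (2 * G w - G 0)) {0..1}"
    by (intro has_integral_diff has_integral_mult_right Cauchy_integral_unit_turn mean_value_unit_turn G w)
  have "(\<lambda>\<zeta>. G \<zeta> * ((1 + cnj w * \<zeta>) / (1 - cnj w * \<zeta>))) holomorphic_on cball 0 1"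
    using nz' by (intro holomorphic_intros G) auto
  from mean_value_unit_turn[OF this]
  have "((\<lambda>t. G (unit_turn t) * ((1 + cnj w * unit_turn t) / (1 - cnj w * unit_turn t))) has_integral G 0) {0..1}"
    by simp
  from iffD2[OF has_integral_cnj this]
  have anti: "((\<lambda>t. cnj (G (unit_turn t) * ((1 + cnj w * unit_turn t) / (1 - cnj w * unit_turn t)))) has_integral cnj (G 0)) {0..1}"
    by (simp add: o_def)
  have "((\<lambda>t. (1 / 2) * ((2 * (G (unit_turn t) * unit_turn t / (unit_turn t - w)) - G (unit_turn t))
        + cnj (G (unit_turn t) * ((1 + cnj w * unit_turn t) / (1 - cnj w * unit_turn t)))))
      has_integral (1 / 2) * ((2 * G w - G 0) + cnj (G 0))) {0..1}"
    by (intro has_integral_mult_right has_integral_add holo anti)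
  moreover have "(1 / 2) * ((2 * (G \<zeta> * \<zeta> / (\<zeta> - w)) - G \<zeta>) + cnj (G \<zeta> * ((1 + cnj w * \<zeta>) / (1 - cnj w * \<zeta>))))
      = of_real (Re (G \<zeta>)) * herglotz_kernel w \<zeta>" if z: "\<zeta> \<in> circle" for \<zeta>
  proof -
    have one: "cnj \<zeta> * \<zeta> = 1"
      using z by (rule circle_cnj_inverse)
    have e1: "2 * (G \<zeta> * \<zeta> / (\<zeta> - w)) - G \<zeta> = G \<zeta> * herglotz_kernel w \<zeta>"
      using nz[OF z] by (simp add: herglotz_kernel_def field_simps)
    have e2: "cnj ((1 + cnj w * \<zeta>) / (1 - cnj w * \<zeta>)) = herglotz_kernel w \<zeta>"
    proof -
      have "1 - w * cnj \<zeta> \<noteq> 0"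
        using nz'[of \<zeta>] z by (metis complex_cnj_cancel_iff complex_cnj_cnj complex_cnj_diff complex_cnj_mult complex_cnj_one complex_cnj_zero mem_sphere_0 order_refl)
      moreover have "(1 + w * cnj \<zeta>) * (\<zeta> - w) = (\<zeta> + w) * (1 - w * cnj \<zeta>)"
        using one by algebra
      ultimately show ?thesis
        using nz[OF z] by (simp add: herglotz_kernel_def frac_eq_eq)
    qed
    have "(1 / 2) * ((2 * (G \<zeta> * \<zeta> / (\<zeta> - w)) - G \<zeta>) + cnj (G \<zeta> * ((1 + cnj w * \<zeta>) / (1 - cnj w * \<zeta>))))
        = (G \<zeta> + cnj (G \<zeta>)) / 2 * herglotz_kernel w \<zeta>"
      unfolding complex_cnj_mult[of "G \<zeta>"] e1 e2 by (simp add: field_simps)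
    also have "(G \<zeta> + cnj (G \<zeta>)) / 2 = of_real (Re (G \<zeta>))"
      by (simp add: complex_add_cnj)
    finally show ?thesis .
  qed
  moreover have "(1 / 2) * ((2 * G w - G 0) + cnj (G 0)) = G w - \<i> * of_real (Im (G 0))"
    by (simp add: complex_eq_iff)
  ultimately show ?thesis
    by (simp only: unit_turn_circle)
qed

text \<open>For \<open>r < 1\<close> the dilation \<open>G (r \<zeta>)\<close> is represented by Schwarz's formula with the measure of density
  \<open>Re G (r \<zeta>) > 0\<close>, whose mass \<open>Re (G 0)\<close> does not depend on \<open>r\<close>. Normalised and written in
  the angle parameter these are probability measures on \<open>[0, 1]\<close>, hence tight, and by Helly's
  theorem a subsequence converges weakly as \<open>r\<close> tends to \<open>1\<close>. The kernel is continuous on the circle, so the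
  formula holds in the limit. The limit measure is pushed to the circle.\<close>

lemma Herglotz_representation:
  assumes G: "G holomorphic_on ball 0 1" and pos: "\<And>w. norm w < 1 \<Longrightarrow> Re (G w) > 0"
  shows "\<exists>\<nu>\<in>circle_measures. \<forall>w. norm w < 1 \<longrightarrow> G w = herglotz (\<nu>, Im (G 0)) w"
proof -
  define m where "m = Re (G 0)"
  have m: "m > 0"
    using pos[of 0] by (simp add: m_def)
  define r where "r n = 1 - inverse (real (Suc n))" for n
  have r: "0 \<le> r n" "r n < 1" for n
    by (simp_all add: r_def inverse_le_1_iff)
  have r_lim: "r \<longlonglongrightarrow> 1"
    unfolding r_def using tendsto_diff[OF tendsto_const LIMSEQ_inverse_real_of_nat, of 1] by simp
  define Gr where "Gr n \<zeta> = G (of_real (r n) * \<zeta>)" for n \<zeta>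
  have in_disc: "norm (of_real (r n) * \<zeta>) < 1" if "norm \<zeta> \<le> 1" for n and \<zeta> :: complex
    using mult_left_mono[OF that r(1)[of n]] r[of n] by (simp add: norm_mult)
  have Gr: "Gr n holomorphic_on cball 0 1" for n
  proof -
    have "(G \<circ> (\<lambda>\<zeta>. of_real (r n) * \<zeta>)) holomorphic_on cball 0 1"
      using in_disc by (intro holomorphic_on_compose_gen[OF _ G] holomorphic_intros) auto
    then show ?thesis
      by (simp add: Gr_def[abs_def] o_def)
  qed
  define dens where "dens n t = indicator {0..1} t * (Re (Gr n (unit_turn t)) / m)" for n t
  have dens_cont: "continuous_on {0..1} (\<lambda>t. Re (Gr n (unit_turn t)) / m)" for n
  proof -
    have "continuous_on {0..1} (\<lambda>t. Gr n (unit_turn t))"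
      by (rule continuous_on_compose2[OF holomorphic_on_imp_continuous_on[OF Gr] unit_turn_continuous])
         (use unit_turn_circle in auto)
    then show ?thesis
      using m by (intro continuous_intros) auto
  qed
  have dens_nonneg: "dens n t \<ge> 0" for n t
    using pos[OF in_disc, of "unit_turn t" n] unit_turn_circle[of t] m
    by (auto simp: dens_def Gr_def indicator_def less_imp_le)
  have dens_int: "integrable lborel (dens n)" for n
    using borel_integrable_compact[OF compact_Icc dens_cont, of n] by (simp add: dens_def[abs_def])
  have dens_meas [measurable]: "dens n \<in> borel_measurable borel" for n
    using borel_measurable_integrable[OF dens_int, of n] by simp
  define \<mu> where "\<mu> n = density lborel (\<lambda>t. ennreal (dens n t))" for n
  have integral_\<mu>: "integral\<^sup>L (\<mu> n) k = integral {0..1} (\<lambda>t. (Re (Gr n (unit_turn t)) / m) *\<^sub>R k t)"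
    if k: "continuous_on UNIV k" for k :: "real \<Rightarrow> complex" and n
  proof -
    have "integral\<^sup>L (\<mu> n) k = (\<integral>t. dens n t *\<^sub>R k t \<partial>lborel)"
      unfolding \<mu>_def using k dens_nonneg
      by (intro integral_density) (auto intro!: borel_measurable_continuous_onI)
    also have "\<dots> = (LINT t:{0..1}|lborel. (Re (Gr n (unit_turn t)) / m) *\<^sub>R k t)"
      by (simp add: set_lebesgue_integral_def dens_def)
    also have "\<dots> = integral {0..1} (\<lambda>t. (Re (Gr n (unit_turn t)) / m) *\<^sub>R k t)"
      by (intro set_borel_integral_eq_integral borel_integrable_atLeastAtMost' continuous_intros dens_cont
            continuous_on_subset[OF k]) auto
    finally show ?thesis .
  qed
  have kernel_cont: "continuous_on A (\<lambda>t. herglotz_kernel w (unit_turn t))" if "norm w < 1" for w A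
    by (rule continuous_on_compose2[OF herglotz_kernel_continuous[OF that] unit_turn_continuous])
       (use unit_turn_circle in blast)
  have Schwarz: "(\<integral>t. herglotz_kernel w (unit_turn t) \<partial>\<mu> n) = (Gr n w - \<i> * of_real (Im (G 0))) / of_real m"
    if w: "norm w < 1" for w n
  proof -
    have "((\<lambda>t. (1 / of_real m) * (of_real (Re (Gr n (unit_turn t))) * herglotz_kernel w (unit_turn t)))
           has_integral (1 / of_real m) * (Gr n w - \<i> * of_real (Im (Gr n 0)))) {0..1}"
      by (intro has_integral_mult_right Schwarz_integral_formula Gr w)
    then show ?thesis
      unfolding integral_\<mu>[OF kernel_cont[OF w]]
      by (intro integral_unique) (simp add: scaleR_conv_of_real Gr_def)
  qed
  have one: "integral\<^sup>L lborel (dens n) = 1" for n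
  proof -
    have "complex_of_real (integral\<^sup>L lborel (dens n)) = (\<integral>t. of_real (dens n t) \<partial>lborel)"
      by simp
    also have "\<dots> = (\<integral>t. dens n t *\<^sub>R 1 \<partial>lborel)"
      by (simp add: scaleR_conv_of_real)
    also have "\<dots> = (\<integral>t. 1 \<partial>\<mu> n)"
      unfolding \<mu>_def using dens_nonneg by (intro integral_density[symmetric]) auto
    also have "\<dots> = (\<integral>t. herglotz_kernel 0 (unit_turn t) \<partial>\<mu> n)"
      by (simp add: herglotz_kernel_def unit_turn_def)
    also have "\<dots> = (G 0 - \<i> * of_real (Im (G 0))) / of_real m"
      by (subst Schwarz) (simp_all add: Gr_def)
    also have "G 0 - \<i> * of_real (Im (G 0)) = of_real m"
      by (simp add: m_def complex_eq_iff)
    finally show ?thesis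
      using m by (metis divide_self_if less_irrefl of_real_eq_0_iff of_real_eq_1_iff)
  qed
  have prob: "prob_space (\<mu> n)" for n
  proof
    have "emeasure (\<mu> n) (space (\<mu> n)) = (\<integral>\<^sup>+ t. ennreal (dens n t) \<partial>lborel)"
      by (simp add: \<mu>_def emeasure_density)
    also have "\<dots> = ennreal (integral\<^sup>L lborel (dens n))"
      using dens_int dens_nonneg by (intro nn_integral_eq_integral) auto
    finally show "emeasure (\<mu> n) (space (\<mu> n)) = 1"
      by (simp add: one)
  qed
  have distr: "real_distribution (\<mu> n)" for n
    using prob by (simp add: real_distribution_def real_distribution_axioms_def \<mu>_def)
  \<comment> \<open>Tightness is stated with half-open intervals; the left end \<open>-1\<close> only serves to include \<open>0\<close>.\<close>
  have supp: "measure (\<mu> n) {-1<..1} = 1" for n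
  proof -
    interpret prob_space "\<mu> n" by (rule prob)
    have "AE t in \<mu> n. t \<in> {-1<..1}"
    proof -
      have "t \<in> {-1<..1}" if "0 < ennreal (dens n t)" for t
        using that by (cases "t \<in> {0..1}") (auto simp: dens_def)
      then show ?thesis
        unfolding \<mu>_def by (subst AE_density) auto
    qed
    then show ?thesis
      by (subst prob_eq_1) (auto simp: \<mu>_def)
  qed
  have "tight \<mu>"
    unfolding tight_def using distr supp by (intro conjI allI impI exI[of _ "-1 :: real"] exI[of _ "1 :: real"]) auto
  from tight_imp_convergent_subsubsequence[OF this strict_mono_id]
  obtain s M where s: "strict_mono (s :: nat \<Rightarrow> nat)" and M: "real_distribution M" and conv: "weak_conv_m (\<mu> \<circ> s) M"
    by auto
  interpret M: real_distribution M by (rule M)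
  have turn_meas: "unit_turn \<in> measurable M circle_borel"
  proof (rule measurable_restrict_space2)
    have "unit_turn \<in> borel_measurable borel"
      by (intro borel_measurable_continuous_onI unit_turn_continuous)
    then show "unit_turn \<in> borel_measurable M"
      by simp
  qed (use unit_turn_circle in blast)
  define \<nu> where "\<nu> = scale_measure (ennreal m) (distr M circle_borel unit_turn)"
  have nu: "\<nu> \<in> circle_measures"
  proof -
    interpret D: prob_space "distr M circle_borel unit_turn"
      using turn_meas by (rule M.prob_space_distr)
    have "finite_measure \<nu>"
      by (rule finite_measureI) (simp add: \<nu>_def ennreal_mult_eq_top_iff)
    then show ?thesis
      by (simp add: circle_measures_def \<nu>_def)
  qed
  have "G w = herglotz (\<nu>, Im (G 0)) w" if w: "norm w < 1" for w
  proof -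
    obtain B where B: "\<And>\<zeta>. \<zeta> \<in> circle \<Longrightarrow> norm (herglotz_kernel w \<zeta>) \<le> B"
      using compact_imp_bounded[OF compact_continuous_image[OF herglotz_kernel_continuous[OF w] compact_sphere]]
      by (metis bounded_iff imageI)
    have "(\<lambda>n. \<integral>t. herglotz_kernel w (unit_turn t) \<partial>(\<mu> \<circ> s) n) \<longlonglongrightarrow> (\<integral>t. herglotz_kernel w (unit_turn t) \<partial>M)"
    proof (rule weak_conv_imp_integral_bdd_continuous_conv[OF _ M conv])
      show "real_distribution ((\<mu> \<circ> s) n)" for n
        using distr by simp
      show "isCont (\<lambda>t. herglotz_kernel w (unit_turn t)) t" for t
        using kernel_cont[OF w, of UNIV] by (simp add: continuous_on_eq_continuous_at)
      show "norm (herglotz_kernel w (unit_turn t)) \<le> B" for t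
        by (rule B[OF unit_turn_circle])
    qed
    moreover have "(\<lambda>n. \<integral>t. herglotz_kernel w (unit_turn t) \<partial>(\<mu> \<circ> s) n) \<longlonglongrightarrow> (G w - \<i> * of_real (Im (G 0))) / of_real m"
    proof -
      have "(\<lambda>n. of_real (r n) * w) \<longlonglongrightarrow> of_real 1 * w"
        by (intro tendsto_intros r_lim)
      moreover have "isCont G (of_real 1 * w)"
        using holomorphic_on_imp_continuous_on[OF G] w by (simp add: continuous_on_eq_continuous_at)
      ultimately have "(\<lambda>n. Gr n w) \<longlonglongrightarrow> G w"
        unfolding Gr_def using isCont_tendsto_compose by fastforce
      from LIMSEQ_subseq_LIMSEQ[OF this s] show ?thesis
        using m by (simp add: Schwarz[OF w]) (intro tendsto_intros; simp add: o_def)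
    qed
    ultimately have lim: "(\<integral>t. herglotz_kernel w (unit_turn t) \<partial>M) = (G w - \<i> * of_real (Im (G 0))) / of_real m"
      by (rule LIMSEQ_unique)
    have "(\<integral>\<zeta>. herglotz_kernel w \<zeta> \<partial>\<nu>) = m *\<^sub>R (\<integral>\<zeta>. herglotz_kernel w \<zeta> \<partial>distr M circle_borel unit_turn)"
      unfolding \<nu>_def using m borel_measurable_continuous_on_restrict[OF herglotz_kernel_continuous[OF w]]
      by (intro integral_scale_measure) simp_all
    also have "(\<integral>\<zeta>. herglotz_kernel w \<zeta> \<partial>distr M circle_borel unit_turn) = (\<integral>t. herglotz_kernel w (unit_turn t) \<partial>M)"
      by (intro integral_distr turn_meas borel_measurable_continuous_on_restrict herglotz_kernel_continuous w)
    finally show ?thesis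
      using m by (simp add: lim herglotz_def scaleR_conv_of_real)
  qed
  with nu show ?thesis
    by blast
qed

section \<open>The Cayley transform\<close>

lemma cayley_inv_of_real_neq: "cayley_inv (of_real s) \<noteq> -1"
proof
  have nz: "\<i> + of_real s \<noteq> 0"
    by (simp add: complex_eq_iff)
  assume "cayley_inv (of_real s) = -1"
  then have "\<i> - of_real s = - (\<i> + of_real s)"
    using nz by (simp add: cayley_inv_def divide_eq_eq)
  then show False
    by (simp add: complex_eq_iff)
qed

lemma cayley_cayley_inv:
  assumes "w \<noteq> - \<i>"
  shows "cayley (cayley_inv w) = w"
proof -
  have nz: "\<i> + w \<noteq> 0"
    using assms by (metis add_eq_0_iff)
  have "1 - cayley_inv w = 2 * w / (\<i> + w)" "1 + cayley_inv w = 2 * \<i> / (\<i> + w)"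
    using nz by (simp_all add: cayley_inv_def field_simps)
  then show ?thesis
    using nz by (simp add: cayley_def)
qed

lemma cayley_circle_real:
  assumes "\<zeta> \<in> circle" "\<zeta> \<noteq> -1"
  shows "of_real (Re (cayley \<zeta>)) = cayley \<zeta>"
proof -
  have nz: "1 + \<zeta> \<noteq> 0"
    using assms(2) by (metis add.inverse_unique)
  have nz': "1 + cnj \<zeta> \<noteq> 0"
    using nz by (metis complex_cnj_add complex_cnj_one complex_cnj_zero_iff)
  have "cnj \<zeta> * \<zeta> = 1"
    using assms(1) by (rule circle_cnj_inverse)
  then have "- \<i> * (1 - cnj \<zeta>) * (1 + \<zeta>) = \<i> * (1 - \<zeta>) * (1 + cnj \<zeta>)"
    by algebra
  then have "(- \<i> * (1 - cnj \<zeta>)) / (1 + cnj \<zeta>) = \<i> * (1 - \<zeta>) / (1 + \<zeta>)"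
    by (simp only: frac_eq_eq[OF nz' nz])
  then have "cnj (cayley \<zeta>) = cayley \<zeta>"
    by (simp add: cayley_def)
  then show ?thesis
    by (simp add: complex_eq_iff)
qed

lemma cayley_upper_half_plane:
  assumes "norm w < 1"
  shows "Im (cayley w) > 0" "cayley_inv (cayley w) = w"
proof -
  have ne: "w \<noteq> -1"
    using assms by auto
  then have nz: "1 + w \<noteq> 0"
    by (metis add.inverse_unique)
  show "cayley_inv (cayley w) = w"
    using ne by (rule cayley_inverse)
  have "Im (cayley w) = Re ((1 - w) / (1 + w))"
    by (simp add: cayley_def flip: times_divide_eq_right)
  also have "\<dots> = (1 - (norm w)\<^sup>2) / (norm (1 + w))\<^sup>2"
    unfolding cmod_power2 by (simp add: Re_divide) (simp add: power2_eq_square algebra_simps)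
  also have "\<dots> > 0"
    using assms nz by (simp add: abs_square_less_1)
  finally show "Im (cayley w) > 0" .
qed

lemma cayley_inv_disc:
  assumes "Im z > 0"
  shows "norm (cayley_inv z) < 1" "cayley (cayley_inv z) = z"
proof -
  have ne: "z \<noteq> - \<i>"
    using assms by auto
  show "cayley (cayley_inv z) = z"
    using ne by (rule cayley_cayley_inv)
  have "(norm (\<i> - z))\<^sup>2 < (norm (\<i> + z))\<^sup>2"
    using assms unfolding cmod_power2 by (simp add: power2_eq_square algebra_simps)
  then have "norm (\<i> - z) < norm (\<i> + z)"
    by (rule power_less_imp_less_base) simp
  moreover from this have "norm (\<i> + z) > 0"
    by (rule le_less_trans[OF norm_ge_zero])
  ultimately show "norm (cayley_inv z) < 1"
    by (simp add: cayley_inv_def norm_divide)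
qed

text \<open>The change of variables that turns the kernel of \<open>Q_reg\<close> into the Herglotz kernel; the second formula produces the
  term \<open>c\<^sub>1 z\<close> from a point mass at \<open>-1\<close>.\<close>

lemma herglotz_kernel_cayley:
  assumes z: "Im z > 0"
  shows "herglotz_kernel (cayley_inv z) (cayley_inv (of_real s)) = \<i> * (1 + of_real s * z) / (z - of_real s)"
    and "herglotz_kernel (cayley_inv z) (-1) = - \<i> * z"
proof -
  have nz: "\<i> + of_real s \<noteq> 0" "\<i> + z \<noteq> 0" "z - of_real s \<noteq> 0"
    using z by (auto simp: complex_eq_iff)
  define D where "D = (\<i> + of_real s) * (\<i> + z)"
  have D: "D \<noteq> 0"
    using nz by (simp add: D_def)
  have "cayley_inv (of_real s) + cayley_inv z = ((\<i> - of_real s) * (\<i> + z) + (\<i> - z) * (\<i> + of_real s)) / D"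
    using nz by (simp add: cayley_inv_def D_def add_frac_eq)
  also have "(\<i> - of_real s) * (\<i> + z) + (\<i> - z) * (\<i> + of_real s) = - 2 * (1 + of_real s * z)"
    by (simp add: algebra_simps)
  finally have sum: "cayley_inv (of_real s) + cayley_inv z = - 2 * (1 + of_real s * z) / D" .
  have "cayley_inv (of_real s) - cayley_inv z = ((\<i> - of_real s) * (\<i> + z) - (\<i> - z) * (\<i> + of_real s)) / D"
    using nz by (simp add: cayley_inv_def D_def diff_frac_eq)
  also have "(\<i> - of_real s) * (\<i> + z) - (\<i> - z) * (\<i> + of_real s) = 2 * \<i> * (z - of_real s)"
    by (simp add: algebra_simps)
  finally have diff: "cayley_inv (of_real s) - cayley_inv z = 2 * \<i> * (z - of_real s) / D" .
  have "- 2 * (1 + of_real s * z) * (z - of_real s) = (\<i> * (1 + of_real s * z)) * (2 * \<i> * (z - of_real s))"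
    by (simp add: algebra_simps)
  then show "herglotz_kernel (cayley_inv z) (cayley_inv (of_real s)) = \<i> * (1 + of_real s * z) / (z - of_real s)"
    unfolding herglotz_kernel_def sum diff using D nz by (simp add: frac_eq_eq)
  have "-1 + cayley_inv z = - 2 * z / (\<i> + z)" "-1 - cayley_inv z = - 2 * \<i> / (\<i> + z)"
    using nz by (simp_all add: cayley_inv_def field_simps)
  then show "herglotz_kernel (cayley_inv z) (-1) = - \<i> * z"
    unfolding herglotz_kernel_def using nz by (simp add: divide_i)
qed

section \<open>Data on the line as measures on the circle\<close>

lemma sets_M2: "lam \<in> M2_nonneg \<Longrightarrow> sets lam = sets borel"
  by (simp add: M2_nonneg_def)

lemma reg_data_subset: "reg_data \<subseteq> reg_data_nonneg"
  by (auto simp: M2_plus_def reg_data_def reg_data_nonneg_def)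

definition weighted :: "real measure \<Rightarrow> real measure" where
  "weighted lam = density lam (\<lambda>s. ennreal (1 / (pi * (1 + s\<^sup>2))))"

lemma weight_pos: "0 < pi * (1 + (s::real)\<^sup>2)"
  by (simp add: add_pos_nonneg)

lemma psi_weighted: "psi lam = distr (weighted lam) circle_borel (\<lambda>s. cayley_inv (of_real s))"
  by (simp add: psi_def weighted_def)

lemma finite_weighted:
  assumes "lam \<in> M2_nonneg"
  shows "finite_measure (weighted lam)"
proof (rule finite_measureI)
  have [measurable_cong]: "sets lam = sets borel"
    using assms by (rule sets_M2)
  have "emeasure (weighted lam) (space (weighted lam)) = (\<integral>\<^sup>+ s. ennreal (1 / (pi * (1 + s\<^sup>2))) \<partial>lam)"
    by (simp add: weighted_def emeasure_density cong: nn_integral_cong)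
  also have "\<dots> \<le> (\<integral>\<^sup>+ s. ennreal (1 / (1 + s\<^sup>2)) \<partial>lam)"
  proof (intro nn_integral_mono ennreal_leI divide_left_mono)
    show "1 + s\<^sup>2 \<le> pi * (1 + s\<^sup>2)" for s :: real
      using mult_right_mono[of 1 pi "1 + s\<^sup>2"] pi_gt3 by simp
    show "0 < pi * (1 + s\<^sup>2) * (1 + s\<^sup>2)" for s :: real
      by (intro mult_pos_pos weight_pos) (simp add: add_pos_nonneg)
  qed simp
  also have "\<dots> < \<infinity>"
    using assms by (simp add: M2_nonneg_def)
  finally show "emeasure (weighted lam) (space (weighted lam)) \<noteq> \<infinity>"
    by simp
qed

lemma cayley_inv_measurable: "(\<lambda>s. cayley_inv (of_real s)) \<in> borel \<rightarrow>\<^sub>M circle_borel"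
proof (rule measurable_restrict_space2)
  show "(\<lambda>s. cayley_inv (of_real s)) \<in> borel_measurable borel"
    unfolding cayley_inv_def by measurable
qed (use norm_cayley_inv_of_real in blast)

lemma cayley_inv_measurable_weighted:
  assumes "lam \<in> M2_nonneg"
  shows "(\<lambda>s. cayley_inv (of_real s)) \<in> weighted lam \<rightarrow>\<^sub>M circle_borel"
  using cayley_inv_measurable measurable_cong_sets[of "weighted lam" borel circle_borel circle_borel] sets_M2[OF assms]
  by (simp add: weighted_def)

lemma psi_circle_measure:
  assumes "lam \<in> M2_nonneg"
  shows "psi lam \<in> circle_measures"
  using finite_measure.finite_measure_distr[OF finite_weighted[OF assms] cayley_inv_measurable_weighted[OF assms]]
  by (simp add: circle_measures_def psi_weighted)

definition mass_at_minus_one :: "real \<Rightarrow> complex measure" where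
  "mass_at_minus_one c = scale_measure (ennreal c) (return circle_borel (-1))"

lemma mass_at_minus_one_circle_measure: "mass_at_minus_one c \<in> circle_measures"
proof -
  have "prob_space (return circle_borel (-1))"
    by (rule prob_space_return) (simp add: space_restrict_space)
  then have "emeasure (return circle_borel (-1)) (space circle_borel) = 1"
    using prob_space.emeasure_space_1 by fastforce
  then have "finite_measure (mass_at_minus_one c)"
    by (intro finite_measureI) (simp add: mass_at_minus_one_def space_scale_measure ennreal_mult_eq_top_iff)
  then show ?thesis
    by (simp add: circle_measures_def mass_at_minus_one_def)
qed

lemma measure_add_circle_measure:
  assumes "\<nu> \<in> circle_measures" "\<nu>' \<in> circle_measures"
  shows "measure_add \<nu> \<nu>' \<in> circle_measures"
proof -
  have "emeasure (measure_add \<nu> \<nu>') (space (measure_add \<nu> \<nu>')) = emeasure \<nu> circle + emeasure \<nu>' circle"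
    using assms circle_measures_space[OF assms(1)] sets.top[of \<nu>]
    by (simp add: emeasure_measure_add circle_measures_def sets_eq_imp_space_eq[OF sets_measure_add] del: sets.top)
  also have "\<dots> < \<infinity>"
    using assms finite_measure.emeasure_finite by (auto simp: circle_measures_def less_top)
  finally have "finite_measure (measure_add \<nu> \<nu>')"
    by (intro finite_measureI) simp
  then show ?thesis
    using assms by (simp add: circle_measures_def sets_measure_add)
qed

lemma Psi_reg_eq: "Psi_reg (lam, c\<^sub>0, c\<^sub>1) = (measure_add (psi lam) (mass_at_minus_one (c\<^sub>1 / pi)), - c\<^sub>0 / pi)"
  by (simp add: Psi_reg_def mass_at_minus_one_def)

lemma Psi_reg_circle_measure:
  assumes "u \<in> reg_data_nonneg"
  shows "fst (Psi_reg u) \<in> circle_measures"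
  using assms by (auto simp: reg_data_nonneg_def Psi_reg_eq
      intro!: measure_add_circle_measure psi_circle_measure mass_at_minus_one_circle_measure)

lemma F_reg_eq_herglotz:
  assumes u: "u \<in> reg_data_nonneg" and z: "Im z > 0"
  shows "F_reg u z = herglotz (Psi_reg u) (cayley_inv z)"
proof -
  obtain lam c\<^sub>0 c\<^sub>1 where ueq: "u = (lam, c\<^sub>0, c\<^sub>1)"
    by (cases u)
  with u have lam: "lam \<in> M2_nonneg" and c1: "c\<^sub>1 \<ge> 0"
    by (auto simp: reg_data_nonneg_def)
  have [measurable_cong]: "sets lam = sets borel"
    using lam by (rule sets_M2)
  define k where "k = herglotz_kernel (cayley_inv z)"
  have w: "norm (cayley_inv z) < 1"
    using z by (rule cayley_inv_disc)
  have k_meas: "k \<in> borel_measurable circle_borel"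
    unfolding k_def by (intro borel_measurable_continuous_on_restrict herglotz_kernel_continuous w)
  have k_int: "integrable \<nu> k" if "\<nu> \<in> circle_measures" for \<nu>
    unfolding k_def using that w by (rule herglotz_kernel_integrable)
  have "(\<integral>\<zeta>. k \<zeta> \<partial>psi lam) = (\<integral>s. k (cayley_inv (of_real s)) \<partial>weighted lam)"
    unfolding psi_weighted by (intro integral_distr cayley_inv_measurable_weighted lam k_meas)
  also have "\<dots> = (\<integral>s. (1 / (pi * (1 + s\<^sup>2))) *\<^sub>R k (cayley_inv (of_real s)) \<partial>lam)"
    unfolding weighted_def
  proof (rule integral_density)
    have "(\<lambda>s. k (cayley_inv (complex_of_real s))) \<in> borel_measurable borel"
      using measurable_compose[OF cayley_inv_measurable k_meas] .
    then show "(\<lambda>s. k (cayley_inv (complex_of_real s))) \<in> borel_measurable lam"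
      by simp
    show "AE s in lam. 0 \<le> 1 / (pi * (1 + s\<^sup>2))"
      by (intro AE_I2 divide_nonneg_nonneg less_imp_le[OF weight_pos]) simp
  qed simp
  also have "\<dots> = Q_reg lam z"
    unfolding Q_reg_def
  proof (intro Bochner_Integration.integral_cong refl)
    fix s :: real
    have nz: "z - of_real s \<noteq> 0"
      using z by (auto simp: complex_eq_iff)
    have nz2: "(1 :: complex) + of_real s ^ 2 \<noteq> 0"
      using weight_pos[of s] by (metis mult_zero_right of_real_1 of_real_add of_real_eq_0_iff of_real_power less_irrefl)
    have "(1 / (pi * (1 + s\<^sup>2))) *\<^sub>R k (cayley_inv (of_real s))
        = (\<i> / pi) * ((1 + of_real s * z) / ((z - of_real s) * (1 + of_real s ^ 2)))"
      unfolding k_def herglotz_kernel_cayley(1)[OF z] by (simp add: scaleR_conv_of_real field_simps)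
    also have "(1 + of_real s * z) / ((z - of_real s) * (1 + of_real s ^ 2))
        = 1 / (z - of_real s) + of_real s / (1 + of_real s ^ 2)"
      using nz nz2 by (simp add: add_frac_eq) (simp add: algebra_simps power2_eq_square)
    finally show "(1 / (pi * (1 + s\<^sup>2))) *\<^sub>R k (cayley_inv (of_real s))
        = (\<i> / pi) * (1 / (z - of_real s) + complex_of_real (s / (1 + s\<^sup>2)))"
      by simp
  qed
  finally have Q: "(\<integral>\<zeta>. k \<zeta> \<partial>psi lam) = Q_reg lam z" .
  have "(\<integral>\<zeta>. k \<zeta> \<partial>mass_at_minus_one (c\<^sub>1 / pi)) = (c\<^sub>1 / pi) *\<^sub>R (\<integral>\<zeta>. k \<zeta> \<partial>return circle_borel (-1))"
    unfolding mass_at_minus_one_def using c1 k_meas by (intro integral_scale_measure) auto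
  also have "(\<integral>\<zeta>. k \<zeta> \<partial>return circle_borel (-1)) = k (-1)"
    by (intro integral_return k_meas) (simp add: space_restrict_space)
  also have "k (-1) = - \<i> * z"
    unfolding k_def by (rule herglotz_kernel_cayley(2)[OF z])
  finally have P: "(\<integral>\<zeta>. k \<zeta> \<partial>mass_at_minus_one (c\<^sub>1 / pi)) = - (\<i> / pi) * (of_real c\<^sub>1 * z)"
    by (simp add: scaleR_conv_of_real)
  have "(\<integral>\<zeta>. k \<zeta> \<partial>measure_add (psi lam) (mass_at_minus_one (c\<^sub>1 / pi))) = Q_reg lam z - (\<i> / pi) * (of_real c\<^sub>1 * z)"
    using psi_circle_measure[OF lam] mass_at_minus_one_circle_measure[of "c\<^sub>1 / pi"]
    by (subst integral_measure_add_complex) (auto simp: Q P k_int circle_measures_def)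
  then show ?thesis
    unfolding ueq Psi_reg_eq by (simp add: herglotz_def F_reg_def k_def algebra_simps)
qed

text \<open>The measure on the line belonging to the part of \<open>\<nu>\<close> off the point \<open>-1\<close>. The restriction is needed
  because \<open>cayley (-1) = 0\<close> in the convention \<open>x / 0 = 0\<close>, so that a mass at \<open>-1\<close> would be moved to \<open>0\<close>.\<close>

definition line_measure :: "complex measure \<Rightarrow> real measure" where
  "line_measure \<nu> = density (distr (density \<nu> (indicator (circle - {-1}))) borel (\<lambda>\<zeta>. Re (cayley \<zeta>)))
     (\<lambda>s. ennreal (pi * (1 + s\<^sup>2)))"

definition Psi_inverse :: "complex measure \<times> real \<Rightarrow> reg_datum" where
  "Psi_inverse = (\<lambda>(\<nu>, b). (line_measure \<nu>, - pi * b, pi * measure \<nu> {-1}))"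

lemma Re_cayley_measurable: "(\<lambda>\<zeta>. Re (cayley \<zeta>)) \<in> borel_measurable borel"
  unfolding cayley_def by measurable

lemma sets_circle_borel_iff: "A \<in> sets circle_borel \<longleftrightarrow> A \<subseteq> circle \<and> A \<in> sets borel"
  by (rule sets_restrict_space_iff) simp

lemma emeasure_punctured_pushforward:
  assumes nu: "\<nu> \<in> circle_measures" and B: "B \<in> sets borel"
  shows "emeasure (distr (density \<nu> (indicator (circle - {-1}))) borel (\<lambda>\<zeta>. Re (cayley \<zeta>))) B
       = emeasure \<nu> {\<zeta> \<in> circle - {-1}. Re (cayley \<zeta>) \<in> B}"
    and "{\<zeta> \<in> circle - {-1}. Re (cayley \<zeta>) \<in> B} \<in> sets \<nu>"
proof -
  have sets_nu: "sets \<nu> = sets circle_borel"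
    using nu by (simp add: circle_measures_def)
  have meas: "(\<lambda>\<zeta>. Re (cayley \<zeta>)) \<in> borel_measurable \<nu>"
    unfolding measurable_cong_sets[OF sets_nu refl] by (rule measurable_restrict_space1[OF Re_cayley_measurable])
  have punct: "circle - {-1} \<in> sets \<nu>"
    unfolding sets_nu sets_circle_borel_iff by (intro conjI Diff_subset sets.Diff) simp_all
  have pre: "(\<lambda>\<zeta>. Re (cayley \<zeta>)) -` B \<inter> space \<nu> \<in> sets \<nu>"
    using meas B by (rule measurable_sets)
  have eq: "{\<zeta> \<in> circle - {-1}. Re (cayley \<zeta>) \<in> B} = (circle - {-1}) \<inter> ((\<lambda>\<zeta>. Re (cayley \<zeta>)) -` B \<inter> space \<nu>)"
    unfolding circle_measures_space[OF nu] by blast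
  show *: "{\<zeta> \<in> circle - {-1}. Re (cayley \<zeta>) \<in> B} \<in> sets \<nu>"
    unfolding eq using punct pre by (rule sets.Int)
  have "emeasure (distr (density \<nu> (indicator (circle - {-1}))) borel (\<lambda>\<zeta>. Re (cayley \<zeta>))) B
      = emeasure (density \<nu> (indicator (circle - {-1}))) ((\<lambda>\<zeta>. Re (cayley \<zeta>)) -` B \<inter> space \<nu>)"
    using meas B by (simp add: emeasure_distr)
  also have "\<dots> = (\<integral>\<^sup>+ \<zeta>. indicator (circle - {-1}) \<zeta> * indicator ((\<lambda>\<zeta>. Re (cayley \<zeta>)) -` B \<inter> space \<nu>) \<zeta> \<partial>\<nu>)"
    using punct pre by (intro emeasure_density) auto
  also have "\<dots> = (\<integral>\<^sup>+ \<zeta>. indicator {\<zeta> \<in> circle - {-1}. Re (cayley \<zeta>) \<in> B} \<zeta> \<partial>\<nu>)"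
    unfolding eq by (simp add: indicator_inter_arith)
  also have "\<dots> = emeasure \<nu> {\<zeta> \<in> circle - {-1}. Re (cayley \<zeta>) \<in> B}"
    using * by simp
  finally show "emeasure (distr (density \<nu> (indicator (circle - {-1}))) borel (\<lambda>\<zeta>. Re (cayley \<zeta>))) B
       = emeasure \<nu> {\<zeta> \<in> circle - {-1}. Re (cayley \<zeta>) \<in> B}" .
qed

lemma emeasure_psi:
  assumes "lam \<in> M2_nonneg" "A \<in> sets circle_borel"
  shows "emeasure (psi lam) A = emeasure (weighted lam) {s. cayley_inv (of_real s) \<in> A}"
proof -
  have "space (weighted lam) = UNIV"
    using sets_eq_imp_space_eq[OF sets_M2[OF assms(1)]] by (simp add: weighted_def)
  then show ?thesis
    unfolding psi_weighted emeasure_distr[OF cayley_inv_measurable_weighted[OF assms(1)] assms(2)]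
    by (simp only: vimage_def Int_UNIV_right)
qed

lemma emeasure_mass_at_minus_one:
  assumes "A \<in> sets circle_borel" "c \<ge> 0"
  shows "emeasure (mass_at_minus_one c) A = ennreal c * indicator A (-1)"
  using assms by (simp add: mass_at_minus_one_def)

lemma density_inverse_weight:
  assumes "sets M = sets borel"
  shows "density (density M (\<lambda>s. ennreal (1 / (pi * (1 + s\<^sup>2))))) (\<lambda>s. ennreal (pi * (1 + s\<^sup>2))) = M"
    and "density (density M (\<lambda>s. ennreal (pi * (1 + s\<^sup>2)))) (\<lambda>s. ennreal (1 / (pi * (1 + s\<^sup>2)))) = M"
proof -
  have [measurable_cong]: "sets M = sets borel"
    by (rule assms)
  have one: "ennreal (1 / (pi * (1 + s\<^sup>2))) * ennreal (pi * (1 + s\<^sup>2)) = 1" for s :: real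
  proof -
    have "1 + s\<^sup>2 \<noteq> 0"
      using weight_pos[of s] by auto
    then show ?thesis
      by (simp flip: ennreal_mult)
  qed
  show "density (density M (\<lambda>s. ennreal (1 / (pi * (1 + s\<^sup>2))))) (\<lambda>s. ennreal (pi * (1 + s\<^sup>2))) = M"
    by (subst density_density_eq) (measurable, simp only: one density_1)
  show "density (density M (\<lambda>s. ennreal (pi * (1 + s\<^sup>2)))) (\<lambda>s. ennreal (1 / (pi * (1 + s\<^sup>2)))) = M"
    by (subst density_density_eq) (measurable, simp only: one mult.commute[of "ennreal (pi * _)"] density_1)
qed

text \<open>The image of the line under \<open>cayley_inv\<close> misses \<open>-1\<close>, so the mass of \<open>Psi_reg u\<close> at that point is
  exactly \<open>c\<^sub>1 / \<pi>\<close>, and the rest is the image of the weighted measure.\<close>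

lemma Psi_inverse_Psi_reg:
  assumes u: "u \<in> reg_data_nonneg"
  shows "Psi_inverse (Psi_reg u) = u"
proof -
  obtain lam c\<^sub>0 c\<^sub>1 where ueq: "u = (lam, c\<^sub>0, c\<^sub>1)"
    by (cases u)
  with u have lam: "lam \<in> M2_nonneg" and c1: "c\<^sub>1 \<ge> 0"
    by (auto simp: reg_data_nonneg_def)
  define \<nu> where "\<nu> = measure_add (psi lam) (mass_at_minus_one (c\<^sub>1 / pi))"
  have nu: "\<nu> \<in> circle_measures"
    unfolding \<nu>_def by (intro measure_add_circle_measure psi_circle_measure mass_at_minus_one_circle_measure lam)
  have sets_nu: "sets \<nu> = sets circle_borel"
    using nu by (simp add: circle_measures_def)
  have em: "emeasure \<nu> A = emeasure (weighted lam) {s. cayley_inv (of_real s) \<in> A} + ennreal (c\<^sub>1 / pi) * indicator A (-1)"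
    if "A \<in> sets circle_borel" for A
    using that c1 psi_circle_measure[OF lam] mass_at_minus_one_circle_measure[of "c\<^sub>1 / pi"]
    by (simp add: \<nu>_def emeasure_measure_add emeasure_psi[OF lam] emeasure_mass_at_minus_one circle_measures_def)
  have "distr (density \<nu> (indicator (circle - {-1}))) borel (\<lambda>\<zeta>. Re (cayley \<zeta>)) = weighted lam"
  proof (rule measure_eqI)
    show "sets (distr (density \<nu> (indicator (circle - {-1}))) borel (\<lambda>\<zeta>. Re (cayley \<zeta>))) = sets (weighted lam)"
      using sets_M2[OF lam] by (simp add: weighted_def)
    fix B assume "B \<in> sets (distr (density \<nu> (indicator (circle - {-1}))) borel (\<lambda>\<zeta>. Re (cayley \<zeta>)))"
    then have B: "B \<in> sets borel"
      by simp
    have "{s. cayley_inv (of_real s) \<in> {\<zeta> \<in> circle - {-1}. Re (cayley \<zeta>) \<in> B}} = B"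
    proof -
      have "cayley (cayley_inv (of_real s)) = of_real s" for s
        by (rule cayley_cayley_inv) (simp add: complex_eq_iff)
      then show ?thesis
        by (simp only: norm_cayley_inv_of_real cayley_inv_of_real_neq mem_Collect_eq Diff_iff singleton_iff Re_complex_of_real simp_thms Collect_mem_eq)
    qed
    moreover have "{\<zeta> \<in> circle - {-1}. Re (cayley \<zeta>) \<in> B} \<in> sets circle_borel"
      using emeasure_punctured_pushforward(2)[OF nu B] unfolding sets_nu .
    ultimately have "emeasure \<nu> {\<zeta> \<in> circle - {-1}. Re (cayley \<zeta>) \<in> B} = emeasure (weighted lam) B"
      using em[of "{\<zeta> \<in> circle - {-1}. Re (cayley \<zeta>) \<in> B}"] by (simp del: mem_sphere_0)
    then show "emeasure (distr (density \<nu> (indicator (circle - {-1}))) borel (\<lambda>\<zeta>. Re (cayley \<zeta>))) B = emeasure (weighted lam) B"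
      unfolding emeasure_punctured_pushforward(1)[OF nu B] .
  qed
  then have "line_measure \<nu> = lam"
    unfolding line_measure_def by (simp add: weighted_def density_inverse_weight(1)[OF sets_M2[OF lam]])
  moreover have "measure \<nu> {-1} = c\<^sub>1 / pi"
  proof -
    have "{-1} \<in> sets circle_borel"
      by (simp add: sets_circle_borel_iff)
    then have "emeasure \<nu> {-1} = ennreal (c\<^sub>1 / pi)"
      by (simp add: em cayley_inv_of_real_neq)
    then show ?thesis
      using c1 by (simp add: measure_def)
  qed
  ultimately show ?thesis
    unfolding ueq Psi_reg_eq \<nu>_def[symmetric] by (simp add: Psi_inverse_def)
qed

text \<open>Splitting off the mass at \<open>-1\<close> and pulling the rest back to the line loses nothing. The resulting
  measure is finite on compact sets because \<open>1 / (1 + s\<^sup>2)\<close> is integrable and bounded below there.\<close>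

lemma Psi_reg_Psi_inverse:
  assumes nu: "\<nu> \<in> circle_measures"
  shows "Psi_inverse (\<nu>, b) \<in> reg_data_nonneg" and "Psi_reg (Psi_inverse (\<nu>, b)) = (\<nu>, b)"
proof -
  interpret finite_measure \<nu>
    using nu by (simp add: circle_measures_def)
  have sets_nu: "sets \<nu> = sets circle_borel"
    using nu by (simp add: circle_measures_def)
  define X where "X = distr (density \<nu> (indicator (circle - {-1}))) borel (\<lambda>\<zeta>. Re (cayley \<zeta>))"
  have sets_X [measurable_cong]: "sets X = sets borel"
    by (simp add: X_def)
  define lam where "lam = line_measure \<nu>"
  have lam_eq: "lam = density X (\<lambda>s. ennreal (pi * (1 + s\<^sup>2)))"
    by (simp add: lam_def line_measure_def X_def)
  have sets_lam [measurable_cong]: "sets lam = sets borel"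
    by (simp add: lam_eq sets_X)
  have X_fin: "emeasure X UNIV < \<infinity>"
  proof -
    have "emeasure X UNIV \<noteq> \<infinity>"
      unfolding X_def by (subst emeasure_punctured_pushforward(1)[OF nu]) simp_all
    then show ?thesis
      by (simp add: less_top)
  qed
  have wt: "weighted lam = X"
    unfolding weighted_def lam_eq by (rule density_inverse_weight(2)[OF sets_X])
  have int: "(\<integral>\<^sup>+ s. ennreal (1 / (1 + s\<^sup>2)) \<partial>lam) < \<infinity>"
  proof -
    have "(\<integral>\<^sup>+ s. ennreal (1 / (1 + s\<^sup>2)) \<partial>lam) = (\<integral>\<^sup>+ s. ennreal (pi * (1 + s\<^sup>2)) * ennreal (1 / (1 + s\<^sup>2)) \<partial>X)"
      unfolding lam_eq by (rule nn_integral_density) measurable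
    also have "\<dots> = (\<integral>\<^sup>+ s. ennreal pi \<partial>X)"
    proof (rule nn_integral_cong)
      fix s :: real
      have "1 + s\<^sup>2 > 0"
        by (simp add: add_pos_nonneg)
      then show "ennreal (pi * (1 + s\<^sup>2)) * ennreal (1 / (1 + s\<^sup>2)) = ennreal pi"
        by (simp flip: ennreal_mult)
    qed
    also have "\<dots> < \<infinity>"
      using X_fin sets_eq_imp_space_eq[OF sets_X] by (simp add: ennreal_mult_less_top)
    finally show ?thesis .
  qed
  have "emeasure lam K < \<infinity>" if "compact K" for K
  proof -
    obtain R where R: "\<And>s. s \<in> K \<Longrightarrow> \<bar>s\<bar> \<le> R"
      using compact_imp_bounded[OF \<open>compact K\<close>] by (auto simp: bounded_iff)
    have "emeasure lam K = (\<integral>\<^sup>+ s. indicator K s \<partial>lam)"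
      using borel_compact[OF \<open>compact K\<close>] by (simp add: sets_lam)
    also have "\<dots> \<le> (\<integral>\<^sup>+ s. ennreal (1 + R\<^sup>2) * ennreal (1 / (1 + s\<^sup>2)) \<partial>lam)"
    proof (rule nn_integral_mono)
      fix s :: real
      show "indicator K s \<le> ennreal (1 + R\<^sup>2) * ennreal (1 / (1 + s\<^sup>2))"
      proof (cases "s \<in> K")
        case True
        have "s\<^sup>2 \<le> R\<^sup>2"
          using R[OF True] by (simp add: abs_le_square_iff[symmetric])
        moreover have "1 + s\<^sup>2 > 0"
          by (simp add: add_pos_nonneg)
        ultimately have "1 \<le> (1 + R\<^sup>2) * (1 / (1 + s\<^sup>2))"
          by simp
        then have "ennreal 1 \<le> ennreal ((1 + R\<^sup>2) * (1 / (1 + s\<^sup>2)))"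
          by (rule ennreal_leI)
        also have "\<dots> = ennreal (1 + R\<^sup>2) * ennreal (1 / (1 + s\<^sup>2))"
          by (rule ennreal_mult) simp_all
        finally show ?thesis
          using True by (simp del: ennreal_plus)
      qed simp
    qed
    also have "\<dots> = ennreal (1 + R\<^sup>2) * (\<integral>\<^sup>+ s. ennreal (1 / (1 + s\<^sup>2)) \<partial>lam)"
      by (rule nn_integral_cmult) measurable
    also have "\<dots> < \<infinity>"
      using int by (simp add: ennreal_mult_less_top)
    finally show ?thesis .
  qed
  then have lam: "lam \<in> M2_nonneg"
    using int by (simp add: M2_nonneg_def lam_eq sets_X)
  then show "Psi_inverse (\<nu>, b) \<in> reg_data_nonneg"
    unfolding Psi_inverse_def prod.case lam_def[symmetric] by (simp add: reg_data_nonneg_def)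
  have m1: "{-1} \<in> sets circle_borel"
    by (simp add: sets_circle_borel_iff)
  have "measure_add (psi lam) (mass_at_minus_one (measure \<nu> {-1})) = \<nu>"
  proof (rule measure_eqI)
    show s: "sets (measure_add (psi lam) (mass_at_minus_one (measure \<nu> {-1}))) = sets \<nu>"
      using psi_circle_measure[OF lam] by (simp add: sets_measure_add circle_measures_def sets_nu)
    fix A assume "A \<in> sets (measure_add (psi lam) (mass_at_minus_one (measure \<nu> {-1})))"
    then have A: "A \<in> sets circle_borel"
      using s sets_nu by simp
    then have A_circle: "A \<subseteq> circle"
      using sets.sets_into_space[OF A] by (simp add: space_restrict_space)
    have B: "{s. cayley_inv (of_real s) \<in> A} \<in> sets borel"
      using measurable_sets[OF cayley_inv_measurable A] by (simp add: vimage_def)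
    have preimage: "{\<zeta> \<in> circle - {-1}. Re (cayley \<zeta>) \<in> {s. cayley_inv (of_real s) \<in> A}} = A - {-1}"
    proof -
      have "cayley_inv (of_real (Re (cayley \<zeta>))) = \<zeta>" if "\<zeta> \<in> circle" "\<zeta> \<noteq> -1" for \<zeta>
        unfolding cayley_circle_real[OF that] by (rule cayley_inverse[OF that(2)])
      then show ?thesis
        using A_circle by auto
    qed
    have "emeasure (measure_add (psi lam) (mass_at_minus_one (measure \<nu> {-1}))) A
        = emeasure (psi lam) A + emeasure (mass_at_minus_one (measure \<nu> {-1})) A"
      using A psi_circle_measure[OF lam] mass_at_minus_one_circle_measure[of "measure \<nu> {-1}"]
      by (intro emeasure_measure_add) (simp_all add: circle_measures_def)
    also have "emeasure (psi lam) A = emeasure \<nu> (A - {-1})"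
      unfolding emeasure_psi[OF lam A] wt X_def emeasure_punctured_pushforward(1)[OF nu B] preimage ..
    also have "emeasure (mass_at_minus_one (measure \<nu> {-1})) A = emeasure \<nu> {-1} * indicator A (-1)"
      using emeasure_mass_at_minus_one[OF A, of "measure \<nu> {-1}"] by (simp add: emeasure_eq_measure)
    also have "emeasure \<nu> (A - {-1}) + emeasure \<nu> {-1} * indicator A (-1) = emeasure \<nu> A"
    proof (cases "-1 \<in> A")
      case True
      then have "A = (A - {-1}) \<union> {-1}"
        by auto
      then show ?thesis
        using A m1 True plus_emeasure[of "A - {-1}" \<nu> "{-1}"] by (simp add: sets_nu)
    qed simp
    finally show "emeasure (measure_add (psi lam) (mass_at_minus_one (measure \<nu> {-1}))) A = emeasure \<nu> A" .
  qed
  then show "Psi_reg (Psi_inverse (\<nu>, b)) = (\<nu>, b)"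
    unfolding Psi_inverse_def prod.case lam_def[symmetric] by (simp add: Psi_reg_eq)
qed

section \<open>The dual datum\<close>

lemma F_reg_injective:
  assumes u: "u \<in> reg_data_nonneg" and v: "v \<in> reg_data_nonneg"
    and eq: "\<And>z. Im z > 0 \<Longrightarrow> F_reg u z = F_reg v z"
  shows "u = v"
proof -
  have "herglotz (Psi_reg u) w = herglotz (Psi_reg v) w" if w: "norm w < 1" for w
    using eq[OF cayley_upper_half_plane(1)[OF w]]
    unfolding F_reg_eq_herglotz[OF u cayley_upper_half_plane(1)[OF w]]
      F_reg_eq_herglotz[OF v cayley_upper_half_plane(1)[OF w]] cayley_upper_half_plane(2)[OF w] .
  then have "Psi_reg u = Psi_reg v"
    using herglotz_unique[OF Psi_reg_circle_measure[OF u] Psi_reg_circle_measure[OF v], of "snd (Psi_reg u)" "snd (Psi_reg v)"]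
    by (simp add: prod_eq_iff)
  then show ?thesis
    using Psi_inverse_Psi_reg[OF u] Psi_inverse_Psi_reg[OF v] by metis
qed

lemma null_circle_measure: "null_measure circle_borel \<in> circle_measures"
proof -
  have "finite_measure (null_measure circle_borel)"
    by (rule finite_measureI) simp
  then show ?thesis
    by (simp add: circle_measures_def)
qed

lemma line_measure_null: "line_measure (null_measure circle_borel) = null_measure borel"
proof -
  have "distr (density (null_measure circle_borel) (indicator (circle - {-1}))) borel (\<lambda>\<zeta>. Re (cayley \<zeta>)) = null_measure borel"
    by (rule measure_eqI) (simp_all only: sets_distr sets_null_measure emeasure_punctured_pushforward(1)[OF null_circle_measure] emeasure_null_measure)
  moreover have "density (null_measure borel) f = null_measure borel" if "f \<in> borel_measurable borel" for f :: "real \<Rightarrow> ennreal"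
  proof (rule measure_eqI)
    fix A :: "real set"
    show "A \<in> sets (density (null_measure borel) f) \<Longrightarrow> emeasure (density (null_measure borel) f) A = emeasure (null_measure borel) A"
      using that by (simp add: emeasure_density nn_integral_null_measure)
  qed simp
  ultimately show ?thesis
    by (simp add: line_measure_def)
qed

lemma Psi_reg_nonnull:
  assumes "t \<in> reg_data"
  shows "fst (Psi_reg t) \<noteq> null_measure circle_borel"
proof
  obtain lam c\<^sub>0 c\<^sub>1 where t: "t = (lam, c\<^sub>0, c\<^sub>1)"
    by (cases t)
  assume null: "fst (Psi_reg t) = null_measure circle_borel"
  have "t \<in> reg_data_nonneg"
    using assms reg_data_subset by blast
  then have "Psi_inverse (fst (Psi_reg t), snd (Psi_reg t)) = t"
    by (simp add: Psi_inverse_Psi_reg)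
  then have "lam = null_measure borel"
    unfolding null by (simp add: Psi_inverse_def line_measure_null t)
  then show False
    using assms by (simp add: t reg_data_def M2_plus_def)
qed

lemma Re_F_reg_pos:
  assumes "t \<in> reg_data" "Im z > 0"
  shows "Re (F_reg t z) > 0"
proof -
  have t: "t \<in> reg_data_nonneg"
    using assms(1) reg_data_subset by blast
  have "Re (herglotz (fst (Psi_reg t), snd (Psi_reg t)) (cayley_inv z)) > 0"
    by (rule Re_herglotz_pos[OF Psi_reg_circle_measure[OF t] Psi_reg_nonnull[OF assms(1)] cayley_inv_disc(1)[OF assms(2)]])
  then show ?thesis
    by (simp add: F_reg_eq_herglotz[OF t assms(2)])
qed

definition dual :: "reg_datum \<Rightarrow> reg_datum \<Rightarrow> bool" where
  "dual t u \<longleftrightarrow> u \<in> reg_data_nonneg \<and> (\<forall>z. Im z > 0 \<longrightarrow> F_reg t z * F_reg u z = 1)"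

text \<open>If \<open>Re H > 0\<close> then \<open>Re (1 / H) = Re H / \<bar>H\<bar>\<^sup>2 > 0\<close>, so \<open>Herglotz_representation\<close>
  applies to the reciprocal.\<close>

lemma dual_exists:
  assumes t: "t \<in> reg_data"
  shows "\<exists>u. dual t u"
proof -
  have tn: "t \<in> reg_data_nonneg"
    using t reg_data_subset by blast
  define H where "H = herglotz (fst (Psi_reg t), snd (Psi_reg t))"
  have F_H: "F_reg t z = H (cayley_inv z)" if "Im z > 0" for z
    by (simp add: H_def F_reg_eq_herglotz[OF tn that])
  have pos: "Re (H w) > 0" if "norm w < 1" for w
    unfolding H_def by (rule Re_herglotz_pos[OF Psi_reg_circle_measure[OF tn] Psi_reg_nonnull[OF t] that])
  then have nz: "H w \<noteq> 0" if "norm w < 1" for w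
    using that by fastforce
  define G where "G w = inverse (H w)" for w
  have "G holomorphic_on ball 0 1"
    unfolding G_def using nz
    by (intro holomorphic_intros herglotz_holomorphic[OF Psi_reg_circle_measure[OF tn], of "snd (Psi_reg t)", folded H_def])
      auto
  moreover have "Re (G w) > 0" if w: "norm w < 1" for w
  proof -
    have "(Re (H w))\<^sup>2 + (Im (H w))\<^sup>2 > 0"
      using pos[OF w] by (simp add: add_pos_nonneg)
    then show ?thesis
      using pos[OF w] by (simp add: G_def)
  qed
  ultimately obtain \<nu> where nu: "\<nu> \<in> circle_measures" and G: "\<And>w. norm w < 1 \<Longrightarrow> G w = herglotz (\<nu>, Im (G 0)) w"
    using Herglotz_representation[of G] by blast
  define u where "u = Psi_inverse (\<nu>, Im (G 0))"
  have u: "u \<in> reg_data_nonneg" "Psi_reg u = (\<nu>, Im (G 0))"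
    using Psi_reg_Psi_inverse[OF nu] by (simp_all add: u_def)
  have "F_reg t z * F_reg u z = 1" if z: "Im z > 0" for z
  proof -
    note w = cayley_inv_disc(1)[OF z]
    have "F_reg u z = G (cayley_inv z)"
      by (simp only: F_reg_eq_herglotz[OF u(1) z] u(2) G[OF w])
    then show ?thesis
      using nz[OF w] by (simp add: F_H[OF z] G_def)
  qed
  with u(1) show ?thesis
    unfolding dual_def by blast
qed

lemma dual_unique:
  assumes "dual t u" "dual t v"
  shows "u = v"
proof (rule F_reg_injective)
  fix z assume z: "Im z > 0"
  with assms have "F_reg t z * F_reg u z = 1" "F_reg t z * F_reg v z = 1"
    by (auto simp: dual_def)
  then show "F_reg u z = F_reg v z"
    by (metis mult.assoc mult.commute mult_1)
qed (use assms in \<open>auto simp: dual_def\<close>)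

lemma dual_ex1: "t \<in> reg_data \<Longrightarrow> \<exists>!u. dual t u"
  using dual_exists dual_unique by blast

lemma dual_B_reg: "t \<in> reg_data \<Longrightarrow> dual t (B_reg t)"
  unfolding B_reg_def using theI'[OF dual_ex1, unfolded dual_def] by (simp add: dual_def)

lemma null_M2_nonneg: "null_measure borel \<in> M2_nonneg"
  by (simp add: M2_nonneg_def nn_integral_null_measure)

lemma point_M2_nonneg:
  "scale_measure (ennreal m) (return borel a) \<in> M2_nonneg"
proof -
  have "(\<integral>\<^sup>+ s. ennreal (1 / (1 + s\<^sup>2)) \<partial>scale_measure (ennreal m) (return borel a)) = ennreal m * ennreal (1 / (1 + a\<^sup>2))"
    by (subst nn_integral_scale_measure) (simp_all add: nn_integral_return)
  then show ?thesis
    by (simp add: M2_nonneg_def borel_compact ennreal_mult_less_top indicator_def)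
qed

lemma F_reg_null:
  fixes z :: complex
  shows "F_reg (null_measure borel, c\<^sub>0, c\<^sub>1) z = - (\<i> / pi) * (of_real c\<^sub>0 + of_real c\<^sub>1 * z)"
proof -
  have "Q_reg (null_measure borel) z = 0"
    unfolding Q_reg_def
    by (intro integral_eq_zero_AE AE_I[of _ _ UNIV]) auto
  then show ?thesis
    by (simp add: F_reg_def)
qed

text \<open>The value of \<open>c\<^sub>0\<close> is the one that cancels the regularising term of the point mass.\<close>

lemma F_reg_point:
  fixes z :: complex
  assumes m: "m > 0"
  shows "F_reg (scale_measure (ennreal m) (return borel a), m * a / (1 + a\<^sup>2), 0) z = \<i> * m / (pi * (z - of_real a))"
proof -
  have "(\<lambda>s. (\<i> / pi) * (1 / (z - complex_of_real s) + complex_of_real (s / (1 + s\<^sup>2)))) \<in> borel_measurable borel"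
    by measurable
  then have "Q_reg (scale_measure (ennreal m) (return borel a)) z
      = m *\<^sub>R ((\<i> / pi) * (1 / (z - complex_of_real a) + complex_of_real (a / (1 + a\<^sup>2))))"
    unfolding Q_reg_def using m by (subst integral_scale_measure) (simp_all add: integral_return)
  then show ?thesis
    by (simp add: F_reg_def scaleR_conv_of_real distrib_left mult_ac)
qed

text \<open>If the dual measure is zero, the dual function is \<open>-(\<i> / \<pi>) (\<zeta>\<^sub>0 + \<zeta>\<^sub>1 z)\<close>. Here \<open>\<zeta>\<^sub>1 = 0\<close> would
  make \<open>F_reg t\<close> a purely imaginary constant, against its positive real part; and for \<open>\<zeta>\<^sub>1 > 0\<close> the
  reciprocal is \<open>F_reg\<close> of a point mass at \<open>-\<zeta>\<^sub>0 / \<zeta>\<^sub>1\<close>, so \<open>t\<close> is that datum by injectivity.\<close>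

lemma degenerate_iff_null_dual:
  assumes t: "t \<in> reg_data" and u: "dual t u"
  shows "degenerate t \<longleftrightarrow> fst u = null_measure borel"
proof
  assume "degenerate t"
  then obtain a m where m: "m > 0" and t_eq: "t = (scale_measure (ennreal m) (return borel a), m * a / (1 + a\<^sup>2), 0)"
    by (cases t) (auto simp: degenerate_def)
  \<comment> \<open>The coefficients of the affine function \<open>pi (z - a) / (\<i> m)\<close>, the reciprocal given by \<open>F_reg_point\<close>.\<close>
  define v where "v = (null_measure borel :: real measure, - pi\<^sup>2 * a / m, pi\<^sup>2 / m)"
  have "F_reg t z * F_reg v z = 1" if "Im z > 0" for z
  proof -
    have nz: "z - of_real a \<noteq> 0"
      using that by (auto simp: complex_eq_iff)
    have v_eq: "F_reg v z = - \<i> * pi / m * (z - of_real a)"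
      using m by (simp add: v_def F_reg_null field_simps power2_eq_square)
    have t_F: "F_reg t z = \<i> * m / (pi * (z - of_real a))"
      unfolding t_eq by (rule F_reg_point[OF m])
    show ?thesis
      unfolding t_F v_eq using m nz by (simp add: field_simps)
  qed
  then have "dual t v"
    using m by (simp add: dual_def v_def reg_data_nonneg_def null_M2_nonneg)
  then show "fst u = null_measure borel"
    using dual_unique[OF u] by (simp add: v_def)
next
  assume null: "fst u = null_measure borel"
  obtain \<zeta>\<^sub>0 \<zeta>\<^sub>1 where u_eq: "u = (null_measure borel, \<zeta>\<^sub>0, \<zeta>\<^sub>1)"
    using null by (cases u) auto
  have \<zeta>1: "\<zeta>\<^sub>1 \<ge> 0"
    using u by (simp add: dual_def u_eq reg_data_nonneg_def)
  have prod: "F_reg t z * (- (\<i> / pi) * (of_real \<zeta>\<^sub>0 + of_real \<zeta>\<^sub>1 * z)) = 1" if "Im z > 0" for z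
    using u that unfolding dual_def u_eq F_reg_null by blast
  have "\<zeta>\<^sub>1 \<noteq> 0"
  proof
    assume "\<zeta>\<^sub>1 = 0"
    then have one: "F_reg t \<i> * (- \<i> * of_real (\<zeta>\<^sub>0 / pi)) = 1"
      using prod[of \<i>] by simp
    have "Im (F_reg t \<i> * (- \<i> * of_real (\<zeta>\<^sub>0 / pi))) = - Re (F_reg t \<i>) * (\<zeta>\<^sub>0 / pi)"
      by simp
    then have "Re (F_reg t \<i>) * (\<zeta>\<^sub>0 / pi) = 0"
      unfolding one by simp
    moreover have "Re (F_reg t \<i>) > 0"
      using t by (rule Re_F_reg_pos) simp
    ultimately have "\<zeta>\<^sub>0 / pi = 0"
      by simp
    with one show False
      by simp
  qed
  with \<zeta>1 have \<zeta>1: "\<zeta>\<^sub>1 > 0"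
    by simp
  \<comment> \<open>The zero of the affine function is the location of the mass.\<close>
  define a m where "a = - \<zeta>\<^sub>0 / \<zeta>\<^sub>1" and "m = pi\<^sup>2 / \<zeta>\<^sub>1"
  have m: "m > 0"
    using \<zeta>1 by (simp add: m_def)
  define v where "v = (scale_measure (ennreal m) (return borel a), m * a / (1 + a\<^sup>2), 0 :: real)"
  have "t = v"
  proof (rule F_reg_injective)
    fix z assume z: "Im z > 0"
    have nz: "z - of_real a \<noteq> 0"
      using z by (auto simp: complex_eq_iff)
    have *: "of_real \<zeta>\<^sub>0 + of_real \<zeta>\<^sub>1 * z = of_real \<zeta>\<^sub>1 * (z - of_real a)"
      using \<zeta>1 by (simp add: a_def field_simps)
    have "F_reg v z * (- (\<i> / pi) * (of_real \<zeta>\<^sub>0 + of_real \<zeta>\<^sub>1 * z)) = 1"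
      unfolding * v_def F_reg_point[OF m] using \<zeta>1 nz by (simp add: m_def power2_eq_square field_simps)
    with prod[OF z] show "F_reg t z = F_reg v z"
      by (metis mult.assoc mult.commute mult_1)
  qed (use t reg_data_subset in \<open>auto simp: v_def reg_data_nonneg_def point_M2_nonneg\<close>)
  then show "degenerate t"
    using m by (auto simp: v_def degenerate_def)
qed

section \<open>Reflection\<close>

definition reflect :: "reg_datum \<Rightarrow> reg_datum" where
  "reflect = (\<lambda>(lam, c\<^sub>0, c\<^sub>1). (distr lam borel uminus, - c\<^sub>0, c\<^sub>1))"

lemma reflect_reg_data_nonneg:
  assumes "u \<in> reg_data_nonneg"
  shows "reflect u \<in> reg_data_nonneg"
proof -
  obtain lam c\<^sub>0 c\<^sub>1 where u: "u = (lam, c\<^sub>0, c\<^sub>1)"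
    by (cases u)
  with assms have lam: "lam \<in> M2_nonneg" and c1: "c\<^sub>1 \<ge> 0"
    by (auto simp: reg_data_nonneg_def)
  have sets_lam: "sets lam = sets borel"
    using lam by (rule sets_M2)
  have space: "space lam = UNIV"
    using sets_eq_imp_space_eq[OF sets_lam] by simp
  have meas: "uminus \<in> borel_measurable lam"
    unfolding measurable_cong_sets[OF sets_lam refl] by measurable
  have "emeasure (distr lam borel uminus) K < \<infinity>" if "compact K" for K
  proof -
    have "emeasure (distr lam borel uminus) K = emeasure lam (uminus -` K)"
      using emeasure_distr[OF meas borel_compact[OF that]] by (simp add: space)
    also have "uminus -` K = uminus ` K"
      by (force simp: image_iff)
    also have "emeasure lam (uminus ` K) < \<infinity>"
      using lam compact_negations[OF that] by (simp add: M2_nonneg_def)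
    finally show ?thesis .
  qed
  moreover have "(\<integral>\<^sup>+ s. ennreal (1 / (1 + s\<^sup>2)) \<partial>distr lam borel uminus) = (\<integral>\<^sup>+ s. ennreal (1 / (1 + s\<^sup>2)) \<partial>lam)"
    using meas by (subst nn_integral_distr) simp_all
  ultimately show ?thesis
    using lam c1 by (simp add: u reflect_def reg_data_nonneg_def M2_nonneg_def)
qed

lemma F_reg_reflect:
  assumes "u \<in> reg_data_nonneg"
  shows "F_reg (reflect u) z = cnj (F_reg u (- cnj z))"
proof -
  obtain lam c\<^sub>0 c\<^sub>1 where u: "u = (lam, c\<^sub>0, c\<^sub>1)"
    by (cases u)
  with assms have sets_lam: "sets lam = sets borel"
    by (auto simp: reg_data_nonneg_def sets_M2)
  have meas: "uminus \<in> borel_measurable lam"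
    unfolding measurable_cong_sets[OF sets_lam refl] by measurable
  have neg: "1 / (z + complex_of_real s) = - (1 / (- z - complex_of_real s))" for s
    by (metis add_uminus_conv_diff minus_add_distrib minus_divide_right minus_minus)
  have "Q_reg (distr lam borel uminus) z
      = (\<integral>s. (\<i> / pi) * (1 / (z - complex_of_real (- s)) + complex_of_real (- s / (1 + (- s)\<^sup>2))) \<partial>lam)"
    unfolding Q_reg_def by (rule integral_distr[OF meas]) measurable
  also have "\<dots> = (\<integral>s. cnj ((\<i> / pi) * (1 / (- cnj z - complex_of_real s) + complex_of_real (s / (1 + s\<^sup>2)))) \<partial>lam)"
    by (intro Bochner_Integration.integral_cong refl) (simp add: neg algebra_simps)
  also have "\<dots> = cnj (Q_reg lam (- cnj z))"
    unfolding Q_reg_def by (rule Bochner_Integration.integral_cnj)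
  finally show ?thesis
    by (simp add: u reflect_def F_reg_def algebra_simps)
qed

lemma dual_reflect:
  assumes t: "t \<in> reg_data_nonneg" and even: "reflect t = t" and u: "dual t u"
  shows "reflect u = u"
proof (rule dual_unique[OF _ u])
  have un: "u \<in> reg_data_nonneg"
    using u by (simp add: dual_def)
  have "F_reg t z * F_reg (reflect u) z = 1" if "Im z > 0" for z
  proof -
    have "F_reg t z * F_reg (reflect u) z = cnj (F_reg t (- cnj z) * F_reg u (- cnj z))"
      using F_reg_reflect[OF t, of z] F_reg_reflect[OF un, of z] by (simp add: even)
    also have "F_reg t (- cnj z) * F_reg u (- cnj z) = 1"
      using u that by (simp add: dual_def)
    finally show ?thesis
      by simp
  qed
  then show "dual t (reflect u)"
    using reflect_reg_data_nonneg[OF un] by (simp add: dual_def)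
qed

section \<open>Reciprocals of Herglotz transforms and weak convergence\<close>

lemma has_fps_expansion_prod_eq_1:
  fixes f g :: "complex \<Rightarrow> complex"
  assumes "f has_fps_expansion P" "g has_fps_expansion Q" and eq: "\<And>w. norm w < 1 \<Longrightarrow> f w * g w = 1"
  shows "P * Q = 1"
proof -
  have "eventually (\<lambda>u :: complex. u \<in> ball 0 1) (nhds 0)"
    by (intro eventually_nhds_in_open) auto
  then have "eventually (\<lambda>w. f w * g w = 1) (nhds 0)"
    by eventually_elim (simp add: eq)
  from has_fps_expansion_cong[OF this refl]
  have "(\<lambda>_. 1) has_fps_expansion P * Q"
    using has_fps_expansion_mult[OF assms(1,2)] by blast
  then show ?thesis
    using fps_expansion_unique_complex has_fps_expansion_1 by blast
qed

text \<open>The Cauchy product of the two Taylor series is the constant series \<open>1\<close>, solved for the coefficient of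
  highest order.\<close>

lemma herglotz_coeff_reciprocal:
  assumes nu: "\<nu> \<in> circle_measures" "\<nu>' \<in> circle_measures"
    and eq: "\<And>w. norm w < 1 \<Longrightarrow> herglotz (\<nu>, b) w * herglotz (\<nu>', b') w = 1"
  shows "herglotz_coeff (\<nu>, b) 0 \<noteq> 0"
    and "herglotz_coeff (\<nu>', b') n
      = ((if n = 0 then 1 else 0) - (\<Sum>i = 1..n. herglotz_coeff (\<nu>, b) i * herglotz_coeff (\<nu>', b') (n - i)))
        / herglotz_coeff (\<nu>, b) 0"
proof -
  have "herglotz_fps (\<nu>, b) * herglotz_fps (\<nu>', b') = 1"
    by (rule has_fps_expansion_prod_eq_1[OF herglotz_has_fps_expansion[OF nu(1)] herglotz_has_fps_expansion[OF nu(2)] eq])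
  then have "fps_nth (herglotz_fps (\<nu>, b) * herglotz_fps (\<nu>', b')) k = fps_nth 1 k" for k
    by simp
  then have c: "(\<Sum>i = 0..k. herglotz_coeff (\<nu>, b) i * herglotz_coeff (\<nu>', b') (k - i)) = (if k = 0 then 1 else 0)" for k
    by (simp add: fps_mult_nth herglotz_fps_def)
  show nz: "herglotz_coeff (\<nu>, b) 0 \<noteq> 0"
    using c[of 0] by auto
  define S where "S = (\<Sum>i = 1..n. herglotz_coeff (\<nu>, b) i * herglotz_coeff (\<nu>', b') (n - i))"
  have "herglotz_coeff (\<nu>, b) 0 * herglotz_coeff (\<nu>', b') n + S = (if n = 0 then 1 else 0)"
    using c[of n] unfolding sum.atLeast_Suc_atMost[OF le0] S_def by simp
  then have "herglotz_coeff (\<nu>, b) 0 * herglotz_coeff (\<nu>', b') n = (if n = 0 then 1 else 0) - S"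
    by (simp only: eq_diff_eq)
  then have "(herglotz_coeff (\<nu>, b) 0 * herglotz_coeff (\<nu>', b') n) / herglotz_coeff (\<nu>, b) 0
      = ((if n = 0 then 1 else 0) - S) / herglotz_coeff (\<nu>, b) 0"
    by (rule arg_cong)
  then show "herglotz_coeff (\<nu>', b') n = ((if n = 0 then 1 else 0)
      - (\<Sum>i = 1..n. herglotz_coeff (\<nu>, b) i * herglotz_coeff (\<nu>', b') (n - i))) / herglotz_coeff (\<nu>, b) 0"
    unfolding nonzero_mult_div_cancel_left[OF nz] S_def .
qed

lemma tendsto_moment:
  assumes nu: "\<And>t. p t \<in> circle_measures" "\<nu> \<in> circle_measures"
    and lim: "\<And>f :: complex \<Rightarrow> real. continuous_on circle f \<Longrightarrow> ((\<lambda>t. \<integral>\<zeta>. f \<zeta> \<partial>p t) \<longlongrightarrow> (\<integral>\<zeta>. f \<zeta> \<partial>\<nu>)) F"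
  shows "((\<lambda>t. moment (p t) k) \<longlongrightarrow> moment \<nu> k) F"
proof -
  have m: "moment \<rho> k = Complex (\<integral>\<zeta>. Re (\<zeta> ^ k) \<partial>\<rho>) (\<integral>\<zeta>. Im (\<zeta> ^ k) \<partial>\<rho>)" if "\<rho> \<in> circle_measures" for \<rho>
  proof -
    have "integrable \<rho> (\<lambda>\<zeta>. \<zeta> ^ k)"
      by (intro continuous_imp_integrable_circle that continuous_intros)
    then show ?thesis
      unfolding moment_def by (simp only: integral_Re integral_Im complex_surj)
  qed
  show ?thesis
    unfolding m[OF nu(1)] m[OF nu(2)] by (intro tendsto_Complex lim continuous_intros)
qed

text \<open>Approximate \<open>f\<close> uniformly by a trigonometric polynomial. The error in the integrals is controlled by the masses,
  which are bounded eventually because the moment of order \<open>0\<close> converges.\<close>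

lemma tendsto_integral_of_moments:
  fixes f :: "complex \<Rightarrow> real"
  assumes nu: "\<And>t. q t \<in> circle_measures" "\<nu> \<in> circle_measures"
    and lim: "\<And>k. ((\<lambda>t. moment (q t) k) \<longlongrightarrow> moment \<nu> k) F"
    and f: "continuous_on circle f"
  shows "((\<lambda>t. \<integral>\<zeta>. f \<zeta> \<partial>q t) \<longlongrightarrow> (\<integral>\<zeta>. f \<zeta> \<partial>\<nu>)) F"
proof -
  have trig: "((\<lambda>t. \<integral>\<zeta>. p \<zeta> \<partial>q t) \<longlongrightarrow> (\<integral>\<zeta>. p \<zeta> \<partial>\<nu>)) F" if "trig_polynomial p" for p
    using that
  proof induction
    case (monomial c k)
    show ?case
      unfolding integral_trig_monomial[OF nu(1)] integral_trig_monomial[OF nu(2)]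
      by (intro tendsto_Re tendsto_mult tendsto_const lim)
  next
    case (add p1 p2)
    have split: "(\<integral>\<zeta>. p1 \<zeta> + p2 \<zeta> \<partial>\<rho>) = (\<integral>\<zeta>. p1 \<zeta> \<partial>\<rho>) + (\<integral>\<zeta>. p2 \<zeta> \<partial>\<rho>)" if "\<rho> \<in> circle_measures" for \<rho>
      by (intro Bochner_Integration.integral_add continuous_imp_integrable_circle that
          trig_polynomial_continuous add.hyps)
    show ?case
      unfolding split[OF nu(1)] split[OF nu(2)] by (intro tendsto_add add.IH)
  qed
  define m where "m = measure \<nu> (space \<nu>) + 1"
  have m: "m > 0"
    by (simp add: m_def add_nonneg_pos)
  have "((\<lambda>t. Re (moment (q t) 0)) \<longlongrightarrow> Re (moment \<nu> 0)) F"
    by (intro tendsto_Re lim)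
  then have mass: "eventually (\<lambda>t. measure (q t) (space (q t)) < m) F"
    unfolding moment_0 Re_complex_of_real by (rule order_tendstoD(2)) (simp add: m_def)
  show ?thesis
  proof (rule tendstoI)
    fix e :: real assume e: "e > 0"
    define d where "d = e / (3 * m)"
    have d: "d > 0" "d * m = e / 3"
      using e m by (simp_all add: d_def)
    obtain p where p: "trig_polynomial p" "\<And>\<zeta>. \<zeta> \<in> circle \<Longrightarrow> \<bar>f \<zeta> - p \<zeta>\<bar> < d"
      using trig_polynomial_dense[OF f d(1)] by blast
    have approx: "\<bar>(\<integral>\<zeta>. f \<zeta> \<partial>\<rho>) - (\<integral>\<zeta>. p \<zeta> \<partial>\<rho>)\<bar> \<le> e / 3"
      if "\<rho> \<in> circle_measures" "measure \<rho> (space \<rho>) < m" for \<rho>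
    proof -
      have "\<bar>(\<integral>\<zeta>. f \<zeta> \<partial>\<rho>) - (\<integral>\<zeta>. p \<zeta> \<partial>\<rho>)\<bar> \<le> d * measure \<rho> (space \<rho>)"
        by (rule integral_circle_approx[OF that(1) f trig_polynomial_continuous[OF p(1)] less_imp_le[OF p(2)]])
      also have "\<dots> \<le> d * m"
        using that(2) d(1) by (intro mult_left_mono) auto
      finally show ?thesis
        by (simp only: d(2))
    qed
    have "eventually (\<lambda>t. dist (\<integral>\<zeta>. p \<zeta> \<partial>q t) (\<integral>\<zeta>. p \<zeta> \<partial>\<nu>) < e / 3) F"
      using e by (intro tendstoD[OF trig[OF p(1)]]) simp
    with mass show "eventually (\<lambda>t. dist (\<integral>\<zeta>. f \<zeta> \<partial>q t) (\<integral>\<zeta>. f \<zeta> \<partial>\<nu>) < e) F"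
    proof eventually_elim
      case (elim t)
      have "\<bar>(\<integral>\<zeta>. f \<zeta> \<partial>q t) - (\<integral>\<zeta>. p \<zeta> \<partial>q t)\<bar> \<le> e / 3" "\<bar>(\<integral>\<zeta>. f \<zeta> \<partial>\<nu>) - (\<integral>\<zeta>. p \<zeta> \<partial>\<nu>)\<bar> \<le> e / 3"
        using approx[OF nu(1) elim(1)] approx[OF nu(2)] by (simp_all add: m_def)
      with elim(2) show ?case
        unfolding dist_real_def by linarith
    qed
  qed
qed

lemma reciprocal_herglotz_tendsto:
  fixes p q :: "'a \<Rightarrow> complex measure \<times> real" and f :: "complex \<Rightarrow> real"
  assumes circ: "\<And>t. fst (p t) \<in> circle_measures" "\<And>t. fst (q t) \<in> circle_measures"
    and recip: "\<And>t w. norm w < 1 \<Longrightarrow> herglotz (p t) w * herglotz (q t) w = 1"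
    and p: "\<And>f :: complex \<Rightarrow> real. continuous_on circle f \<Longrightarrow> ((\<lambda>t. \<integral>\<zeta>. f \<zeta> \<partial>fst (p t)) \<longlongrightarrow> (\<integral>\<zeta>. f \<zeta> \<partial>fst (p t0))) F"
    and b: "((\<lambda>t. snd (p t)) \<longlongrightarrow> snd (p t0)) F"
  shows "continuous_on circle f \<Longrightarrow> ((\<lambda>t. \<integral>\<zeta>. f \<zeta> \<partial>fst (q t)) \<longlongrightarrow> (\<integral>\<zeta>. f \<zeta> \<partial>fst (q t0))) F"
    and "((\<lambda>t. snd (q t)) \<longlongrightarrow> snd (q t0)) F"
proof -
  define P Q where "P t = herglotz_coeff (p t)" and "Q t = herglotz_coeff (q t)" for t
  have P_eq: "P t n = (if n = 0 then moment (fst (p t)) 0 + \<i> * of_real (snd (p t)) else 2 * cnj (moment (fst (p t)) n))" for t n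
    by (simp add: P_def herglotz_coeff_def case_prod_unfold)
  have Q_eq: "Q t n = (if n = 0 then moment (fst (q t)) 0 + \<i> * of_real (snd (q t)) else 2 * cnj (moment (fst (q t)) n))" for t n
    by (simp add: Q_def herglotz_coeff_def case_prod_unfold)
  have recip': "herglotz (fst (p t), snd (p t)) w * herglotz (fst (q t), snd (q t)) w = 1" if "norm w < 1" for t w
    using recip[OF that] by simp
  have P0: "P t 0 \<noteq> 0" for t
    using herglotz_coeff_reciprocal(1)[OF circ recip'] by (simp add: P_def)
  have Q_rec: "Q t n = ((if n = 0 then 1 else 0) - (\<Sum>i = 1..n. P t i * Q t (n - i))) / P t 0" for t n
    using herglotz_coeff_reciprocal(2)[OF circ recip', of t n] by (simp add: P_def Q_def)
  have P_lim: "((\<lambda>t. P t n) \<longlongrightarrow> P t0 n) F" for n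
  proof -
    have mom: "((\<lambda>t. moment (fst (p t)) k) \<longlongrightarrow> moment (fst (p t0)) k) F" for k
      by (intro tendsto_moment circ p)
    show ?thesis
      unfolding P_eq by (cases "n = 0") (auto intro!: tendsto_intros mom b)
  qed
  have Q_lim: "((\<lambda>t. Q t n) \<longlongrightarrow> Q t0 n) F" for n
  proof (induction n rule: less_induct)
    case (less n)
    have "((\<lambda>t. ((if n = 0 then 1 else 0) - (\<Sum>i = 1..n. P t i * Q t (n - i))) / P t 0)
        \<longlongrightarrow> ((if n = 0 then 1 else 0) - (\<Sum>i = 1..n. P t0 i * Q t0 (n - i))) / P t0 0) F"
      by (intro tendsto_divide tendsto_diff tendsto_const tendsto_sum tendsto_mult P_lim P0 less.IH) auto
    then show ?case
      by (simp only: Q_rec[symmetric])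
  qed
  have mom: "((\<lambda>t. moment (fst (q t)) k) \<longlongrightarrow> moment (fst (q t0)) k) F" for k
  proof (cases "k = 0")
    case True
    have "((\<lambda>t. complex_of_real (Re (Q t 0))) \<longlongrightarrow> of_real (Re (Q t0 0))) F"
      by (intro tendsto_intros Q_lim)
    then show ?thesis
      by (simp add: True Q_eq moment_0)
  next
    case False
    have "((\<lambda>t. cnj (Q t k) / 2) \<longlongrightarrow> cnj (Q t0 k) / 2) F"
      by (intro tendsto_intros Q_lim) simp
    then show ?thesis
      using False by (simp add: Q_eq)
  qed
  show "((\<lambda>t. \<integral>\<zeta>. f \<zeta> \<partial>fst (q t)) \<longlongrightarrow> (\<integral>\<zeta>. f \<zeta> \<partial>fst (q t0))) F" if "continuous_on circle f"
    by (rule tendsto_integral_of_moments[OF circ(2) circ(2) mom that])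
  have "((\<lambda>t. Im (Q t 0)) \<longlongrightarrow> Im (Q t0 0)) F"
    by (intro tendsto_intros Q_lim)
  then show "((\<lambda>t. snd (q t)) \<longlongrightarrow> snd (q t0)) F"
    by (simp add: Q_eq moment_0)
qed

section \<open>Continuity and conclusion\<close>

lemma topspace_weak_topology_S1: "topspace weak_topology_S1 = M_plus_S1"
proof
  show "topspace weak_topology_S1 \<subseteq> M_plus_S1"
    unfolding weak_topology_S1_def topology_generated_by_topspace by blast
  show "M_plus_S1 \<subseteq> topspace weak_topology_S1"
    unfolding weak_topology_S1_def topology_generated_by_topspace
  proof
    fix \<nu> assume "\<nu> \<in> M_plus_S1"
    then have "\<nu> \<in> {\<nu> \<in> M_plus_S1. (\<integral>x. (\<lambda>_. 0 :: real) x \<partial>\<nu>) \<in> UNIV}"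
      by simp
    moreover have "continuous_on circle (\<lambda>_. 0 :: real)" "open (UNIV :: real set)"
      by simp_all
    ultimately show "\<nu> \<in> \<Union> {{\<nu> \<in> M_plus_S1. (\<integral>x. f x \<partial>\<nu>) \<in> U} | (f :: complex \<Rightarrow> real) U. continuous_on circle f \<and> open U}"
      by blast
  qed
qed

text \<open>Immediate from the subbasis, which consists of the preimages of open sets under these integrals.\<close>

lemma continuous_map_weak_integral:
  fixes f :: "complex \<Rightarrow> real"
  assumes "continuous_on circle f"
  shows "continuous_map weak_topology_S1 euclideanreal (\<lambda>\<nu>. \<integral>x. f x \<partial>\<nu>)"
  unfolding continuous_map_def
proof (intro conjI allI impI)
  fix U :: "real set" assume "openin euclideanreal U"
  then have "open U"
    by simp
  then show "openin weak_topology_S1 {\<nu> \<in> topspace weak_topology_S1. (\<integral>x. f x \<partial>\<nu>) \<in> U}"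
    unfolding topspace_weak_topology_S1 unfolding weak_topology_S1_def
    using assms by (intro topology_generated_by_Basis) blast
qed simp

lemma continuous_map_into_weak:
  assumes "\<And>t. t \<in> topspace X \<Longrightarrow> g t \<in> M_plus_S1"
    and "\<And>f :: complex \<Rightarrow> real. continuous_on circle f \<Longrightarrow> continuous_map X euclideanreal (\<lambda>t. \<integral>x. f x \<partial>g t)"
  shows "continuous_map X weak_topology_S1 g"
  unfolding weak_topology_S1_def
proof (rule continuous_on_generated_topo)
  have "topspace weak_topology_S1 = \<Union> {{\<nu> \<in> M_plus_S1. (\<integral>x. f x \<partial>\<nu>) \<in> U} | (f :: complex \<Rightarrow> real) U. continuous_on circle f \<and> open U}"
    unfolding weak_topology_S1_def by (rule topology_generated_by_topspace)
  then show "g ` topspace X \<subseteq> \<Union> {{\<nu> \<in> M_plus_S1. (\<integral>x. f x \<partial>\<nu>) \<in> U} | (f :: complex \<Rightarrow> real) U. continuous_on circle f \<and> open U}"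
    using assms(1) by (simp only: topspace_weak_topology_S1) blast
  fix V assume "V \<in> {{\<nu> \<in> M_plus_S1. (\<integral>x. f x \<partial>\<nu>) \<in> U} | (f :: complex \<Rightarrow> real) U. continuous_on circle f \<and> open U}"
  then obtain f :: "complex \<Rightarrow> real" and U where f: "continuous_on circle f" and U: "open U"
    and V: "V = {\<nu> \<in> M_plus_S1. (\<integral>x. f x \<partial>\<nu>) \<in> U}"
    by blast
  have "openin X {t \<in> topspace X. (\<integral>x. f x \<partial>g t) \<in> U}"
    using openin_continuous_map_preimage[OF assms(2)[OF f], of U] U by simp
  also have "{t \<in> topspace X. (\<integral>x. f x \<partial>g t) \<in> U} = g -` V \<inter> topspace X"
    using assms(1) by (auto simp: V)
  finally show "openin X (g -` V \<inter> topspace X)" .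
qed

lemma M_plus_S1_eq: "M_plus_S1 = circle_measures - {null_measure circle_borel}"
  by (auto simp: M_plus_S1_def circle_measures_def)

text \<open>If the circle measure of the dual were zero, the dual function would be an imaginary constant, and so would its reciprocal \<open>F_reg t\<close>,
  whose real part is positive.\<close>

lemma Psi_reg_dual_nonnull:
  assumes t: "t \<in> reg_data" and u: "dual t u"
  shows "fst (Psi_reg u) \<in> M_plus_S1"
proof -
  have un: "u \<in> reg_data_nonneg" and one: "F_reg t \<i> * F_reg u \<i> = 1"
    using u by (auto simp: dual_def)
  have "fst (Psi_reg u) \<noteq> null_measure circle_borel"
  proof
    assume null: "fst (Psi_reg u) = null_measure circle_borel"
    define b where "b = snd (Psi_reg u)"
    have "Psi_reg u = (null_measure circle_borel, b)"
      using null by (simp add: b_def prod_eq_iff)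
    then have "F_reg u \<i> = \<i> * of_real b"
      using F_reg_eq_herglotz[OF un, of \<i>] by (simp add: herglotz_def integral_null_measure)
    with one have eq: "F_reg t \<i> * (\<i> * of_real b) = 1"
      by simp
    have "Im (F_reg t \<i> * (\<i> * of_real b)) = Re (F_reg t \<i>) * b"
      by simp
    then have "Re (F_reg t \<i>) * b = 0"
      unfolding eq by simp
    moreover have "Re (F_reg t \<i>) > 0"
      using t by (rule Re_F_reg_pos) simp
    ultimately have "b = 0"
      by simp
    with eq show False
      by simp
  qed
  then show ?thesis
    using Psi_reg_circle_measure[OF un] by (simp add: M_plus_S1_eq)
qed

text \<open>Continuity of \<open>B_reg\<close> means continuity of the integrals of test functions against its image on the circle, and of the
  imaginary constant. These are limits along the filters of punctured neighbourhoods, which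
  \<open>reciprocal_herglotz_tendsto\<close> provides.\<close>

lemma continuous_map_B_reg: "continuous_map (reg_topology reg_data) (reg_topology reg_data_nonneg) B_reg"
proof -
  define X where "X = reg_topology reg_data"
  have X_sub: "t \<in> reg_data" if "t \<in> topspace X" for t
    using that by (simp add: X_def reg_topology_def topspace_pullback_topology)
  have X_nonneg: "t \<in> reg_data_nonneg" if "t \<in> topspace X" for t
    using X_sub[OF that] reg_data_subset by blast
  have dual: "dual t (B_reg t)" if "t \<in> topspace X" for t
    using X_sub[OF that] by (rule dual_B_reg)
  have B_nonneg: "B_reg t \<in> reg_data_nonneg" if "t \<in> topspace X" for t
    using dual[OF that] by (simp add: dual_def)
  define p q where "p t = Psi_reg t" and "q t = Psi_reg (B_reg t)" for t
  have "continuous_map X (prod_topology weak_topology_S1 euclideanreal) (id \<circ> Psi_reg)"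
    unfolding X_def reg_topology_def by (intro continuous_map_pullback continuous_map_id)
  then have p_cont: "continuous_map X weak_topology_S1 (\<lambda>t. fst (p t))" "continuous_map X euclideanreal (\<lambda>t. snd (p t))"
    by (simp_all add: continuous_map_pairwise o_def p_def)
  have p_int: "continuous_map X euclideanreal (\<lambda>t. \<integral>\<zeta>. f \<zeta> \<partial>fst (p t))" if "continuous_on circle f" for f :: "complex \<Rightarrow> real"
    using continuous_map_compose[OF p_cont(1) continuous_map_weak_integral[OF that]] by (simp add: o_def)
  have recip: "herglotz (p t) w * herglotz (q t) w = 1" if t: "t \<in> topspace X" and w: "norm w < 1" for t w
  proof -
    note z = cayley_upper_half_plane[OF w]
    have "F_reg t (cayley w) * F_reg (B_reg t) (cayley w) = 1"
      using dual[OF t] z(1) by (simp add: dual_def)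
    then show ?thesis
      unfolding F_reg_eq_herglotz[OF X_nonneg[OF t] z(1)] F_reg_eq_herglotz[OF B_nonneg[OF t] z(1)] z(2) p_def q_def .
  qed
  have lims: "((\<lambda>t. snd (q t)) \<longlongrightarrow> snd (q t0)) (atin X t0)"
    "continuous_on circle f \<Longrightarrow> ((\<lambda>t. \<integral>\<zeta>. f \<zeta> \<partial>fst (q t)) \<longlongrightarrow> (\<integral>\<zeta>. f \<zeta> \<partial>fst (q t0))) (atin X t0)"
    if t0: "t0 \<in> topspace X" for t0 and f :: "complex \<Rightarrow> real"
  proof -
    \<comment> \<open>\<open>reciprocal_herglotz_tendsto\<close> makes assumptions at every point. The filter never sees the points
      outside \<open>topspace X\<close>, so they may be mapped to \<open>t0\<close>.\<close>
    define c where "c t = (if t \<in> topspace X then t else t0)" for t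
    have c: "c t \<in> topspace X" "c t0 = t0" for t
      using t0 by (auto simp: c_def)
    have "eventually (\<lambda>t. t \<in> topspace X) (atin X t0)"
      unfolding eventually_atin using openin_topspace by blast
    then have ev: "eventually (\<lambda>t. c t = t) (atin X t0)"
      by eventually_elim (simp add: c_def)
    have transfer: "((\<lambda>t. h (c t)) \<longlongrightarrow> l) (atin X t0) \<longleftrightarrow> (h \<longlongrightarrow> l) (atin X t0)" for h :: "reg_datum \<Rightarrow> real" and l
      by (rule tendsto_cong) (use ev in eventually_elim, simp)
    have lim_p: "((\<lambda>t. \<integral>\<zeta>. f \<zeta> \<partial>fst (p (c t))) \<longlongrightarrow> (\<integral>\<zeta>. f \<zeta> \<partial>fst (p (c t0)))) (atin X t0)"
      if "continuous_on circle f" for f :: "complex \<Rightarrow> real"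
      using p_int[OF that] t0 unfolding transfer[of "\<lambda>t. \<integral>\<zeta>. f \<zeta> \<partial>fst (p t)"] c(2) by (simp add: continuous_map_atin)
    have lim_b: "((\<lambda>t. snd (p (c t))) \<longlongrightarrow> snd (p (c t0))) (atin X t0)"
      using p_cont(2) t0 unfolding transfer[of "\<lambda>t. snd (p t)"] c(2) by (simp add: continuous_map_atin)
    have circ: "fst (p (c t)) \<in> circle_measures" "fst (q (c t)) \<in> circle_measures" for t
      using Psi_reg_circle_measure[OF X_nonneg[OF c(1)]] Psi_reg_circle_measure[OF B_nonneg[OF c(1)]]
      by (simp_all add: p_def q_def)
    note recip_c = recip[OF c(1)]
    show "((\<lambda>t. snd (q t)) \<longlongrightarrow> snd (q t0)) (atin X t0)"
      using reciprocal_herglotz_tendsto(2)[of "\<lambda>t. p (c t)" "\<lambda>t. q (c t)" t0 "atin X t0", OF circ recip_c lim_p lim_b]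
      unfolding transfer[of "\<lambda>t. snd (q t)"] c(2) .
    show "((\<lambda>t. \<integral>\<zeta>. f \<zeta> \<partial>fst (q t)) \<longlongrightarrow> (\<integral>\<zeta>. f \<zeta> \<partial>fst (q t0))) (atin X t0)" if "continuous_on circle f"
      using reciprocal_herglotz_tendsto(1)[of "\<lambda>t. p (c t)" "\<lambda>t. q (c t)" t0 "atin X t0", OF circ recip_c lim_p lim_b that]
      unfolding transfer[of "\<lambda>t. \<integral>\<zeta>. f \<zeta> \<partial>fst (q t)"] c(2) .
  qed
  have "continuous_map X (prod_topology weak_topology_S1 euclideanreal) (Psi_reg \<circ> B_reg)"
    unfolding continuous_map_pairwise
  proof (intro conjI)
    show "continuous_map X weak_topology_S1 (fst \<circ> (Psi_reg \<circ> B_reg))"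
    proof (rule continuous_map_into_weak)
      show "(fst \<circ> (Psi_reg \<circ> B_reg)) t \<in> M_plus_S1" if "t \<in> topspace X" for t
        using Psi_reg_dual_nonnull[OF X_sub[OF that] dual[OF that]] by simp
      show "continuous_map X euclideanreal (\<lambda>t. \<integral>x. f x \<partial>(fst \<circ> (Psi_reg \<circ> B_reg)) t)"
        if "continuous_on circle f" for f :: "complex \<Rightarrow> real"
        using lims(2)[OF _ that] by (simp add: continuous_map_atin q_def)
    qed
    show "continuous_map X euclideanreal (snd \<circ> (Psi_reg \<circ> B_reg))"
      using lims(1) by (simp add: continuous_map_atin q_def o_def)
  qed
  then have "continuous_map X (pullback_topology reg_data_nonneg Psi_reg (prod_topology weak_topology_S1 euclideanreal)) B_reg"
    by (rule continuous_map_pullback') (use B_nonneg in blast)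
  then show ?thesis
    by (simp add: X_def reg_topology_def)
qed

theorem theorem4p21:
  shows
    "(\<forall>lam\<in>M2_plus. \<forall>c\<^sub>0::real. \<forall>c\<^sub>1\<ge>0.
        (\<exists>!u. u \<in> reg_data_nonneg \<and>
            (\<forall>z. Im z > 0 \<longrightarrow> F_reg (lam, c\<^sub>0, c\<^sub>1) z * F_reg u z = 1)) \<and>
        ((\<exists>!u. u \<in> reg_data \<and>
            (\<forall>z. Im z > 0 \<longrightarrow> F_reg (lam, c\<^sub>0, c\<^sub>1) z * F_reg u z = 1))
          \<longleftrightarrow> \<not> degenerate (lam, c\<^sub>0, c\<^sub>1))) \<and>
     continuous_map (reg_topology reg_data) (reg_topology reg_data_nonneg) B_reg \<and>
     (\<forall>lam\<in>M2_plus. \<forall>c\<^sub>1\<ge>0. even_measure lam \<longrightarrow>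
        (\<forall>\<mu> \<zeta>\<^sub>0 \<zeta>\<^sub>1. B_reg (lam, 0, c\<^sub>1) = (\<mu>, \<zeta>\<^sub>0, \<zeta>\<^sub>1) \<longrightarrow> even_measure \<mu> \<and> \<zeta>\<^sub>0 = 0))"
proof (intro conjI ballI allI impI continuous_map_B_reg)
  fix lam and c\<^sub>0 c\<^sub>1 :: real
  assume "lam \<in> M2_plus" "c\<^sub>1 \<ge> 0"
  then have t: "(lam, c\<^sub>0, c\<^sub>1) \<in> reg_data"
    by (simp add: reg_data_def)
  show "\<exists>!u. u \<in> reg_data_nonneg \<and> (\<forall>z. Im z > 0 \<longrightarrow> F_reg (lam, c\<^sub>0, c\<^sub>1) z * F_reg u z = 1)"
    using dual_ex1[OF t] unfolding dual_def .
  obtain u where u: "dual (lam, c\<^sub>0, c\<^sub>1) u"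
    using dual_exists[OF t] by blast
  have reg_data_iff: "v \<in> reg_data \<longleftrightarrow> v \<in> reg_data_nonneg \<and> fst v \<noteq> null_measure borel" for v
    by (auto simp: reg_data_def reg_data_nonneg_def M2_plus_def)
  have iff: "(v \<in> reg_data \<and> (\<forall>z. Im z > 0 \<longrightarrow> F_reg (lam, c\<^sub>0, c\<^sub>1) z * F_reg v z = 1))
      \<longleftrightarrow> v = u \<and> \<not> degenerate (lam, c\<^sub>0, c\<^sub>1)" for v
    using dual_unique[OF u, of v] degenerate_iff_null_dual[OF t u] u
    unfolding reg_data_iff dual_def by blast
  show "(\<exists>!u. u \<in> reg_data \<and> (\<forall>z. Im z > 0 \<longrightarrow> F_reg (lam, c\<^sub>0, c\<^sub>1) z * F_reg u z = 1))
      \<longleftrightarrow> \<not> degenerate (lam, c\<^sub>0, c\<^sub>1)"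
    unfolding iff by blast
next
  fix lam \<mu> and c\<^sub>1 \<zeta>\<^sub>0 \<zeta>\<^sub>1 :: real
  assume *: "lam \<in> M2_plus" "c\<^sub>1 \<ge> 0" "even_measure lam" "B_reg (lam, 0, c\<^sub>1) = (\<mu>, \<zeta>\<^sub>0, \<zeta>\<^sub>1)"
  then have t: "(lam, 0, c\<^sub>1) \<in> reg_data"
    by (simp add: reg_data_def)
  have "reflect (lam, 0, c\<^sub>1) = (lam, 0, c\<^sub>1)"
    using * by (simp add: reflect_def even_measure_def)
  then have "reflect (\<mu>, \<zeta>\<^sub>0, \<zeta>\<^sub>1) = (\<mu>, \<zeta>\<^sub>0, \<zeta>\<^sub>1)"
    using dual_reflect[OF _ _ dual_B_reg[OF t]] t reg_data_subset * by auto
  then show "even_measure \<mu>" "\<zeta>\<^sub>0 = 0"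
    by (simp_all add: reflect_def even_measure_def)
qed

end
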